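(* Let $1<p\le 3$, $\theta\in(0,1)$ and $k>1$. Let $\delta_0>0$ (depending on $\theta,k$) be such that for every $\delta\in(0,\delta_0)$ and every $b\in C^2([0,\infty)\times\mathbf{R})$ satisfying $$|\partial_t^{\alpha}\partial_x^{\beta}b(t,x)|\le \frac{\delta}{(1+t)^{k+\alpha}}\quad(\alpha,\beta\in\{0,1\},\ (t,x)\in[0,\infty)\times\mathbf{R})\qquad(\mathrm{A})$$ there is a solution $h\in C^2([0,\infty)\times\mathbf{R})$ of $$h_{tt}-h_{xx}-b\,h_t-\Big(\frac{b}{1+t}+b_t\Big)(1+h)=0\quad\text{on }[0,\infty)\times\mathbf{R}\qquad(\mathrm{H})$$ satisfying, for some constant $C>0$ and all $(t,x)\in[0,\infty)\times\mathbf{R}$, $$|h(t,x)|\le \frac{\theta}{(1+t)^{k-1}},\qquad |h_t(t,x)|+|h_x(t,x)|\le\frac{C}{(1+t)^{k}}\qquad(\mathrm{B})$$ (such a $\delta_0$ exists). Let $\delta\in(0,\delta_0)$, let $b\in C^2([0,\infty)\times\mathbf{R})$ satisfy (A), let $a(t,x)=\frac{2}{1+t}+b(t,x)$, let $h$ be such a solution of (H) satisfying (B), and put $g(t,x)=(1+t)(1+h(t,x))$. Let $(u_0,u_1)\in H^1(\mathbf{R})\times L^2(\mathbf{R})$ satisfy $$\liminf_{R\to\infty}\int_{-R}^{R}\Big(\big(-g_t(0,x)+g(0,x)a(0,x)\big)u_0(x)+g(0,x)u_1(x)\Big)\,dx>0 .$$ Then the local solution $u$ of $$u_{tt}-u_{xx}+a(t,x)u_t=|u|^p,\quad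 (t,x)\in(0,\infty)\times\mathbf{R},\qquad (u,u_t)(0,x)=(u_0,u_1)(x),$$ blows up in finite time, that is, its maximal existence time $T^*$ is finite and $\lim_{t\to T^*-0}\|(u,u_t)(t)\|_{H^1\times L^2}=+\infty$.
   Context: For $T\in(0,\infty]$ let $X(T)=C([0,T);H^1(\mathbf{R}))\cap C^1([0,T);L^2(\mathbf{R}))$. A real-valued $u\in X(T)$ is a solution of the initial value problem on $[0,T)$ if for every $\psi\in C_0^2([0,T)\times\mathbf{R})$ (compact support in $[0,T)\times\mathbf{R}$, not necessarily vanishing at $t=0$) $$\int_{[0,T)\times\mathbf{R}}u\,(\partial_t^2\psi-\partial_x^2\psi-\partial_t(a\psi))\,dx\,dt=\int_{\mathbf{R}}\{(a(0,x)u_0(x)+u_1(x))\psi(0,x)-u_0(x)\partial_t\psi(0,x)\}\,dx+\int_{[0,T)\times\mathbf{R}}|u|^p\psi\,dx\,dt .$$ If $T=\infty$, $u$ is a global solution. Known local existence (may be assumed): for $1<p<\infty$ and $(u_0,u_1)\in H^1(\mathbf{R})\times L^2(\mathbf{R})$ there exist a (maximal) $T^*\in(0,+\infty]$ and a unique solution $u\in X(T^* )$, called the local solution; moreover if $T^*<+\infty$ then $\lim_{t\to T^*-0}\|(u,u_t)(t)\|_{H^1\times L^2}=+\infty$. *)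

theory Defs
  imports "HOL-Analysis.Analysis"
begin

subsection \<open>Functions of time and space\<close>

definition time_set :: "ereal \<Rightarrow> real set" where
  "time_set T = {t. 0 \<le> t \<and> ereal t < T}"

text \<open>Functions of \<open>(t, x)\<close> are curried, and only their values for \<open>t \<ge> 0\<close> matter: the time
  derivative is one-sided at \<open>t = 0\<close>. Since \<open>time_set T\<close> is relatively open in \<open>{0..}\<close>, at its points
  \<open>Dt\<close> depends only on the values of the function on \<open>time_set T\<close>.\<close>

definition Dt :: "(real \<Rightarrow> real \<Rightarrow> real) \<Rightarrow> real \<Rightarrow> real \<Rightarrow> real" where
  "Dt f t x = vector_derivative (\<lambda>s. f s x) (at t within {0..})"

definition Dx :: "(real \<Rightarrow> real \<Rightarrow> real) \<Rightarrow> real \<Rightarrow> real \<Rightarrow> real" where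
  "Dx f t x = vector_derivative (\<lambda>y. f t y) (at x)"

definition C1_strip :: "ereal \<Rightarrow> (real \<Rightarrow> real \<Rightarrow> real) \<Rightarrow> bool" where
  "C1_strip T f \<longleftrightarrow>
     (\<forall>t\<in>time_set T. \<forall>x. (\<lambda>s. f s x) differentiable (at t within {0..})
                      \<and> (\<lambda>y. f t y) differentiable (at x)) \<and>
     continuous_on (time_set T \<times> UNIV) (\<lambda>(t, x). f t x) \<and>
     continuous_on (time_set T \<times> UNIV) (\<lambda>(t, x). Dt f t x) \<and>
     continuous_on (time_set T \<times> UNIV) (\<lambda>(t, x). Dx f t x)"

definition C2_strip :: "ereal \<Rightarrow> (real \<Rightarrow> real \<Rightarrow> real) \<Rightarrow> bool" where
  "C2_strip T f \<longleftrightarrow> C1_strip T f \<and> C1_strip T (Dt f) \<and> C1_strip T (Dx f)"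

text \<open>\<open>C\<^sub>0\<^sup>2([0,T) \<times> R)\<close>: the compact support may meet \<open>t = 0\<close> but stays away from \<open>t = T\<close>.\<close>

definition C2_compact_support :: "ereal \<Rightarrow> (real \<Rightarrow> real \<Rightarrow> real) \<Rightarrow> bool" where
  "C2_compact_support T \<psi> \<longleftrightarrow> C2_strip T \<psi> \<and>
     (\<exists>K. compact K \<and> K \<subseteq> time_set T \<times> UNIV \<and>
          (\<forall>t\<in>time_set T. \<forall>x. (t, x) \<notin> K \<longrightarrow> \<psi> t x = 0))"

subsection \<open>The spaces \<open>L\<^sup>2(R)\<close> and \<open>H\<^sup>1(R)\<close>\<close>

text \<open>Elements are represented by Borel functions; equality in these spaces is equality almost
  everywhere.\<close>

definition L2 :: "(real \<Rightarrow> real) \<Rightarrow> bool" where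
  "L2 f \<longleftrightarrow> f \<in> borel_measurable lborel \<and> integrable lborel (\<lambda>x. (f x)\<^sup>2)"

definition L2_norm :: "(real \<Rightarrow> real) \<Rightarrow> real" where
  "L2_norm f = sqrt (LINT x|lborel. (f x)\<^sup>2)"

definition smooth_compact_support :: "(real \<Rightarrow> real) \<Rightarrow> bool" where
  "smooth_compact_support \<phi> \<longleftrightarrow>
     (\<forall>n x. ((deriv ^^ n) \<phi>) field_differentiable (at x)) \<and> compact (closure {x. \<phi> x \<noteq> 0})"

definition is_weak_deriv :: "(real \<Rightarrow> real) \<Rightarrow> (real \<Rightarrow> real) \<Rightarrow> bool" where
  "is_weak_deriv f f' \<longleftrightarrow>
     (\<forall>\<phi>. smooth_compact_support \<phi> \<longrightarrow>
        (LINT x|lborel. f x * deriv \<phi> x) = - (LINT x|lborel. f' x * \<phi> x))"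

definition H1 :: "(real \<Rightarrow> real) \<Rightarrow> bool" where
  "H1 f \<longleftrightarrow> L2 f \<and> (\<exists>f'. L2 f' \<and> is_weak_deriv f f')"

definition weak_deriv :: "(real \<Rightarrow> real) \<Rightarrow> real \<Rightarrow> real" where
  "weak_deriv f = (SOME f'. L2 f' \<and> is_weak_deriv f f')"

definition H1_norm :: "(real \<Rightarrow> real) \<Rightarrow> real" where
  "H1_norm f = sqrt ((L2_norm f)\<^sup>2 + (L2_norm (weak_deriv f))\<^sup>2)"

subsection \<open>The space \<open>X(T)\<close>\<close>

definition has_L2_time_deriv :: "(real \<Rightarrow> real \<Rightarrow> real) \<Rightarrow> real \<Rightarrow> (real \<Rightarrow> real) \<Rightarrow> bool" where
  "has_L2_time_deriv u t v \<longleftrightarrow> L2 v \<and>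
     ((\<lambda>s. L2_norm (\<lambda>x. (u s x - u t x) / (s - t) - v x)) \<longlongrightarrow> 0) (at t within {0..})"

definition L2_time_deriv :: "(real \<Rightarrow> real \<Rightarrow> real) \<Rightarrow> real \<Rightarrow> real \<Rightarrow> real" where
  "L2_time_deriv u t = (SOME v. has_L2_time_deriv u t v)"

text \<open>\<open>X(T) = C([0,T); H\<^sup>1(R)) \<inter> C\<^sup>1([0,T); L\<^sup>2(R))\<close>. Joint measurability is no restriction on the
  curve \<open>t \<mapsto> u(t)\<close>: it only says that the representatives of the classes \<open>u(t)\<close> are chosen so
  that the integrals over \<open>[0,T) \<times> R\<close> below are meaningful.\<close>

definition X_space :: "ereal \<Rightarrow> (real \<Rightarrow> real \<Rightarrow> real) \<Rightarrow> bool" where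
  "X_space T u \<longleftrightarrow>
     set_borel_measurable lborel (time_set T \<times> UNIV) (\<lambda>(t, x). u t x) \<and>
     (\<forall>t\<in>time_set T.
        H1 (u t) \<and>
        ((\<lambda>s. H1_norm (\<lambda>x. u s x - u t x)) \<longlongrightarrow> 0) (at t within {0..}) \<and>
        (\<exists>v. has_L2_time_deriv u t v) \<and>
        ((\<lambda>s. L2_norm (\<lambda>x. L2_time_deriv u s x - L2_time_deriv u t x)) \<longlongrightarrow> 0)
          (at t within {0..}))"

definition state_norm :: "(real \<Rightarrow> real \<Rightarrow> real) \<Rightarrow> real \<Rightarrow> real" where
  "state_norm u t = sqrt ((H1_norm (u t))\<^sup>2 + (L2_norm (L2_time_deriv u t))\<^sup>2)"

subsection \<open>Weak solutions of \<open>u\<^sub>t\<^sub>t - u\<^sub>x\<^sub>x + a u\<^sub>t = |u|\<^sup>p\<close>\<close>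

text \<open>For \<open>u\<close> in \<open>X(T)\<close> and \<open>a\<close> of class \<open>C\<^sup>2\<close> all integrals converge; the integrability clauses are
  written out because a divergent integral has the junk value \<open>0\<close>.\<close>

definition weak_solution ::
  "(real \<Rightarrow> real \<Rightarrow> real) \<Rightarrow> real \<Rightarrow> (real \<Rightarrow> real) \<Rightarrow> (real \<Rightarrow> real) \<Rightarrow>
     ereal \<Rightarrow> (real \<Rightarrow> real \<Rightarrow> real) \<Rightarrow> bool" where
  "weak_solution a p u0 u1 T u \<longleftrightarrow> 0 < T \<and> X_space T u \<and>
     (\<forall>\<psi>. C2_compact_support T \<psi> \<longrightarrow>
       (let F = (\<lambda>(t, x). u t x * (Dt (Dt \<psi>) t x - Dx (Dx \<psi>) t x
                                    - Dt (\<lambda>s y. a s y * \<psi> s y) t x));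
            I = (\<lambda>x. (a 0 x * u0 x + u1 x) * \<psi> 0 x - u0 x * Dt \<psi> 0 x);
            N = (\<lambda>(t, x). \<bar>u t x\<bar> powr p * \<psi> t x)
        in set_integrable lborel (time_set T \<times> UNIV) F \<and>
           integrable lborel I \<and>
           set_integrable lborel (time_set T \<times> UNIV) N \<and>
           (LINT z:(time_set T \<times> UNIV)|lborel. F z) =
             (LINT x|lborel. I x) + (LINT z:(time_set T \<times> UNIV)|lborel. N z)))"

definition local_solution ::
  "(real \<Rightarrow> real \<Rightarrow> real) \<Rightarrow> real \<Rightarrow> (real \<Rightarrow> real) \<Rightarrow> (real \<Rightarrow> real) \<Rightarrow>
     ereal \<Rightarrow> (real \<Rightarrow> real \<Rightarrow> real) \<Rightarrow> bool" where
  "local_solution a p u0 u1 T u \<longleftrightarrow> weak_solution a p u0 u1 T u \<and>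
     (\<forall>T' v. weak_solution a p u0 u1 T' v \<longrightarrow> T' \<le> T)"

definition norm_blows_up :: "ereal \<Rightarrow> (real \<Rightarrow> real \<Rightarrow> real) \<Rightarrow> bool" where
  "norm_blows_up T u \<longleftrightarrow> filterlim (state_norm u) at_top (at_left (real_of_ereal T))"

text \<open>The classical local existence theorem, for a given coefficient and exponent: existence of a
  maximal solution, its uniqueness, and the blow-up alternative.\<close>

definition local_existence :: "(real \<Rightarrow> real \<Rightarrow> real) \<Rightarrow> real \<Rightarrow> bool" where
  "local_existence a p \<longleftrightarrow>
     (\<forall>u0 u1. H1 u0 \<longrightarrow> L2 u1 \<longrightarrow>
       (\<exists>T u. local_solution a p u0 u1 T u \<and>
          (\<forall>v. weak_solution a p u0 u1 T v \<longrightarrow>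
             (\<forall>t\<in>time_set T. AE x in lborel. v t x = u t x)) \<and>
          (T < \<infinity> \<longrightarrow> norm_blows_up T u)))"

subsection \<open>The perturbation \<open>b\<close> and the corrector \<open>h\<close>\<close>

definition condA :: "real \<Rightarrow> real \<Rightarrow> (real \<Rightarrow> real \<Rightarrow> real) \<Rightarrow> bool" where
  "condA k \<delta> b \<longleftrightarrow>
     (\<forall>\<alpha>\<in>{0, 1::nat}. \<forall>\<beta>\<in>{0, 1::nat}. \<forall>t\<ge>0. \<forall>x.
        \<bar>(Dt ^^ \<alpha>) ((Dx ^^ \<beta>) b) t x\<bar> \<le> \<delta> / (1 + t) powr (k + real \<alpha>))"

definition eqH :: "(real \<Rightarrow> real \<Rightarrow> real) \<Rightarrow> (real \<Rightarrow> real \<Rightarrow> real) \<Rightarrow> bool" where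
  "eqH b h \<longleftrightarrow>
     (\<forall>t\<ge>0. \<forall>x. Dt (Dt h) t x - Dx (Dx h) t x - b t x * Dt h t x
        - (b t x / (1 + t) + Dt b t x) * (1 + h t x) = 0)"

definition condB :: "real \<Rightarrow> real \<Rightarrow> (real \<Rightarrow> real \<Rightarrow> real) \<Rightarrow> bool" where
  "condB \<theta> k h \<longleftrightarrow>
     (\<exists>C>0. \<forall>t\<ge>0. \<forall>x.
        \<bar>h t x\<bar> \<le> \<theta> / (1 + t) powr (k - 1) \<and>
        \<bar>Dt h t x\<bar> + \<bar>Dx h t x\<bar> \<le> C / (1 + t) powr k)"

definition admissible_threshold :: "real \<Rightarrow> real \<Rightarrow> real \<Rightarrow> bool" where
  "admissible_threshold \<theta> k \<delta>\<^sub>0 \<longleftrightarrow> \<delta>\<^sub>0 > 0 \<and>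
     (\<forall>\<delta> b. 0 < \<delta> \<longrightarrow> \<delta> < \<delta>\<^sub>0 \<longrightarrow> C2_strip \<infinity> b \<longrightarrow> condA k \<delta> b \<longrightarrow>
        (\<exists>h. C2_strip \<infinity> h \<and> eqH b h \<and> condB \<theta> k h))"

end

theory Submission
  imports Defs
begin

text \<open>The function \<open>g\<close> solves the adjoint equation \<open>g\<^sub>t\<^sub>t - g\<^sub>x\<^sub>x - (a g)\<^sub>t = 0\<close> and is comparable to
  \<open>1 + t\<close>. If \<open>u\<close> were global, test the equation with \<open>g \<phi>\<^sub>R\<close>, where
  \<open>\<phi>\<^sub>R = (1 - (t\<^sup>2 + x\<^sup>2) / R\<^sup>2)\<^sub>+\<^sup>m\<close> and \<open>m\<close> is at least twice the conjugate exponent of \<open>p\<close>. The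
  adjoint operator then only hits derivatives of \<open>\<phi>\<^sub>R\<close> and is of size \<open>(1 + t + |x|) / R\<^sup>2\<close>, so by
  Young's inequality the left-hand side is at most
  \<open>\<kappa> \<integral>|u|\<^sup>p g \<phi>\<^sub>R w\<^sub>R\<^sup>p + K \<kappa> powr (- 1 / (p - 1))\<close> with \<open>w\<^sub>R = (1 + t + |x|) / (3 R) \<le> 1\<close>; the
  constant \<open>K\<close> is independent of \<open>R\<close> precisely because \<open>p \<le> 3\<close>. Taking \<open>\<kappa> = 1 / 2\<close> shows that
  \<open>|u|\<^sup>p g\<close> is integrable, so the first term tends to \<open>0\<close> as \<open>R \<rightarrow> \<infinity>\<close> by dominated convergence, and
  letting \<open>\<kappa> \<rightarrow> \<infinity>\<close> contradicts the positivity of the data. Finite \<open>T\<close> together with uniqueness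
  then yields the blow-up of the norm.\<close>

subsection \<open>Calculus on the half plane\<close>

lemma time_set_infinity [simp]: "time_set \<infinity> = {0..}"
  by (auto simp: time_set_def)

text \<open>The half line contains a right neighbourhood of \<open>t\<close>, also at
  \<open>t = 0\<close>. This makes the one-sided derivative in \<open>Dt\<close> unique, so that any
  derivative found by the calculus rules is its value.\<close>

lemma at_within_atLeast_neq_bot: "t \<ge> 0 \<Longrightarrow> at t within {0::real..} \<noteq> bot"
  using at_le[of "{t<..}" "{0..}" t] trivial_limit_at_right_real[of t]
  by (metis atLeast_iff bot.extremum_uniqueI dual_order.strict_implies_order greaterThan_iff
      order_trans subsetI)

lemma Dt_eq:
  assumes "t \<ge> 0" "((\<lambda>s. f s x) has_real_derivative d) (at t within {0..})"
  shows "Dt f t x = d"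
  using assms unfolding Dt_def
  by (intro vector_derivative_within at_within_atLeast_neq_bot)
     (auto simp: has_real_derivative_iff_has_vector_derivative)

lemma Dx_eq:
  assumes "((\<lambda>y. f t y) has_real_derivative d) (at x)"
  shows "Dx f t x = d"
  using assms unfolding Dx_def
  by (intro vector_derivative_at) (auto simp: has_real_derivative_iff_has_vector_derivative)

lemma C1_strip_Dt:
  assumes "C1_strip \<infinity> f" "t \<ge> 0"
  shows "((\<lambda>s. f s x) has_real_derivative Dt f t x) (at t within {0..})"
  using assms unfolding Dt_def C1_strip_def
  by (auto simp: has_real_derivative_iff_has_vector_derivative vector_derivative_works)

lemma C1_strip_Dx:
  assumes "C1_strip \<infinity> f" "t \<ge> 0"
  shows "((\<lambda>y. f t y) has_real_derivative Dx f t x) (at x)"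
  using assms unfolding Dx_def C1_strip_def
  by (auto simp: has_real_derivative_iff_has_vector_derivative vector_derivative_works)

lemma C1_strip_continuous:
  assumes "C1_strip \<infinity> f"
  shows "continuous_on ({0..} \<times> UNIV) (\<lambda>(t, x). f t x)"
    "continuous_on ({0..} \<times> UNIV) (\<lambda>(t, x). Dt f t x)"
    "continuous_on ({0..} \<times> UNIV) (\<lambda>(t, x). Dx f t x)"
  using assms unfolding C1_strip_def by auto

lemma C1_stripI:
  assumes "\<And>t x. t \<ge> 0 \<Longrightarrow> ((\<lambda>s. f s x) has_real_derivative ft t x) (at t within {0..})"
    and "\<And>t x. t \<ge> 0 \<Longrightarrow> ((\<lambda>y. f t y) has_real_derivative fx t x) (at x)"
    and "continuous_on ({0..} \<times> UNIV) (\<lambda>(t, x). f t x)"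
    and "continuous_on ({0..} \<times> UNIV) (\<lambda>(t, x). ft t x)"
    and "continuous_on ({0..} \<times> UNIV) (\<lambda>(t, x). fx t x)"
  shows "C1_strip \<infinity> f"
proof -
  have 1: "Dt f t x = ft t x" "Dx f t x = fx t x" if "t \<ge> 0" for t x
    using Dt_eq Dx_eq assms(1,2) that by blast+
  have 2: "continuous_on ({0..} \<times> UNIV) (\<lambda>(t, x). Dt f t x)"
    by (rule continuous_on_eq[OF assms(4)]) (auto simp: 1)
  have 3: "continuous_on ({0..} \<times> UNIV) (\<lambda>(t, x). Dx f t x)"
    by (rule continuous_on_eq[OF assms(5)]) (auto simp: 1)
  show ?thesis
    unfolding C1_strip_def using assms(1-3) 2 3
    by (fastforce simp: real_differentiable_def)
qed

text \<open>Formulas for first derivatives are available only for \<open>t \<ge> 0\<close>. Since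
  the filter in \<open>Dt\<close> is restricted to \<open>{0..}\<close>, they may still be
  substituted under an outer derivative, which is how second derivatives are computed below.\<close>

lemma Dt_cong:
  assumes "\<And>t x. t \<ge> 0 \<Longrightarrow> f t x = f' t x" "t \<ge> 0"
  shows "Dt f t x = Dt f' t x"
  unfolding Dt_def
  by (rule vector_derivative_cong_eq)
     (use assms in \<open>auto intro: always_eventually\<close>)

lemma Dx_cong:
  assumes "\<And>t x. t \<ge> 0 \<Longrightarrow> f t x = f' t x" "t \<ge> 0"
  shows "Dx f t x = Dx f' t x"
proof -
  have "f t = f' t" using assms by blast
  then show ?thesis by (simp add: Dx_def)
qed

lemma C1_strip_cong:
  assumes eq: "\<And>t x. t \<ge> 0 \<Longrightarrow> f t x = f' t x" and f: "C1_strip \<infinity> f"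
  shows "C1_strip \<infinity> f'"
proof (rule C1_stripI[where ft = "Dt f" and fx = "Dx f"])
  fix t x :: real assume t: "t \<ge> 0"
  show "((\<lambda>s. f' s x) has_real_derivative Dt f t x) (at t within {0..})"
    by (rule has_field_derivative_transform_within[OF C1_strip_Dt[OF f t] zero_less_one])
       (use t eq in auto)
  show "(f' t has_real_derivative Dx f t x) (at x)"
    using C1_strip_Dx[OF f t, of x] eq[OF t] by (simp add: ext[of "f t" "f' t"])
next
  show "continuous_on ({0..} \<times> UNIV) (\<lambda>(t, x). f' t x)"
    by (rule continuous_on_eq[OF C1_strip_continuous(1)[OF f]]) (auto simp: eq)
qed (use C1_strip_continuous[OF f] in auto)

section \<open>Sums and products of C^1 and C^2 functions on the half plane\<close>

lemma C1_strip_add: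
  assumes f: "C1_strip \<infinity> f" and f': "C1_strip \<infinity> f'"
  shows "C1_strip \<infinity> (\<lambda>t x. f t x + f' t x)"
proof -
  have cont: "continuous_on ({0..} \<times> UNIV) (\<lambda>z. e (fst z) (snd z))"
    if "e \<in> {f, Dt f, Dx f, f', Dt f', Dx f'}" for e
    using that C1_strip_continuous[OF f] C1_strip_continuous[OF f']
    by (auto simp: case_prod_unfold)
  show ?thesis
  proof (rule C1_stripI[where ft = "\<lambda>t x. Dt f t x + Dt f' t x"
        and fx = "\<lambda>t x. Dx f t x + Dx f' t x"])
    show "((\<lambda>s. f s x + f' s x) has_real_derivative Dt f t x + Dt f' t x) (at t within {0..})"
      if "t \<ge> 0" for t x
      by (rule DERIV_add[OF C1_strip_Dt[OF f that] C1_strip_Dt[OF f' that], THEN DERIV_cong]) simp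
    show "((\<lambda>y. f t y + f' t y) has_real_derivative Dx f t x + Dx f' t x) (at x)"
      if "t \<ge> 0" for t x
      by (rule DERIV_add[OF C1_strip_Dx[OF f that] C1_strip_Dx[OF f' that], THEN DERIV_cong]) simp
  qed (unfold case_prod_unfold, (intro continuous_intros cont; simp)+)
qed

lemma C1_strip_mult:
  assumes f: "C1_strip \<infinity> f" and f': "C1_strip \<infinity> f'"
  shows "C1_strip \<infinity> (\<lambda>t x. f t x * f' t x)"
proof -
  have cont: "continuous_on ({0..} \<times> UNIV) (\<lambda>z. e (fst z) (snd z))"
    if "e \<in> {f, Dt f, Dx f, f', Dt f', Dx f'}" for e
    using that C1_strip_continuous[OF f] C1_strip_continuous[OF f']
    by (auto simp: case_prod_unfold)
  show ?thesis
  proof (rule C1_stripI[where ft = "\<lambda>t x. Dt f t x * f' t x + f t x * Dt f' t x"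
        and fx = "\<lambda>t x. Dx f t x * f' t x + f t x * Dx f' t x"])
    show "((\<lambda>s. f s x * f' s x) has_real_derivative Dt f t x * f' t x + f t x * Dt f' t x) (at t within {0..})"
      if "t \<ge> 0" for t x
      by (rule DERIV_mult[OF C1_strip_Dt[OF f that] C1_strip_Dt[OF f' that], THEN DERIV_cong]) simp
    show "((\<lambda>y. f t y * f' t y) has_real_derivative Dx f t x * f' t x + f t x * Dx f' t x) (at x)"
      if "t \<ge> 0" for t x
      by (rule DERIV_mult[OF C1_strip_Dx[OF f that] C1_strip_Dx[OF f' that], THEN DERIV_cong]) simp
  qed (unfold case_prod_unfold, (intro continuous_intros cont; simp)+)
qed

lemma Dt_mult:
  assumes "C1_strip \<infinity> f" "C1_strip \<infinity> f'" "t \<ge> 0"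
  shows "Dt (\<lambda>s y. f s y * f' s y) t x = Dt f t x * f' t x + f t x * Dt f' t x"
  by (rule Dt_eq) (use assms in \<open>auto intro!: derivative_eq_intros C1_strip_Dt\<close>)

lemma Dx_mult:
  assumes "C1_strip \<infinity> f" "C1_strip \<infinity> f'" "t \<ge> 0"
  shows "Dx (\<lambda>s y. f s y * f' s y) t x = Dx f t x * f' t x + f t x * Dx f' t x"
  by (rule Dx_eq) (use assms in \<open>auto intro!: derivative_eq_intros C1_strip_Dx\<close>)

lemma Dt_add:
  assumes "C1_strip \<infinity> f" "C1_strip \<infinity> f'" "t \<ge> 0"
  shows "Dt (\<lambda>s y. f s y + f' s y) t x = Dt f t x + Dt f' t x"
  by (rule Dt_eq) (use assms in \<open>auto intro!: derivative_eq_intros C1_strip_Dt\<close>)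

lemma Dx_add:
  assumes "C1_strip \<infinity> f" "C1_strip \<infinity> f'" "t \<ge> 0"
  shows "Dx (\<lambda>s y. f s y + f' s y) t x = Dx f t x + Dx f' t x"
  by (rule Dx_eq) (use assms in \<open>auto intro!: derivative_eq_intros C1_strip_Dx\<close>)

lemma C1_strip_time_fun:
  assumes "\<And>t. t \<ge> 0 \<Longrightarrow> (q has_real_derivative q' t) (at t within {0..})"
    and "continuous_on {0..} q'"
  shows "C1_strip \<infinity> (\<lambda>t x. q t)"
proof -
  have "continuous_on {0..} q"
    using assms(1) by (intro DERIV_continuous_on[of "{0..}" q q']) auto
  then have "continuous_on ({0..} \<times> UNIV) (\<lambda>(t, x::real). q t)"
    "continuous_on ({0..} \<times> UNIV) (\<lambda>(t, x::real). q' t)"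
    using assms(2) unfolding case_prod_unfold
    by (auto intro!: continuous_on_compose2[OF _ continuous_on_fst[OF continuous_on_id]])
  then show ?thesis
    by (intro C1_stripI[where ft = "\<lambda>t x. q' t" and fx = "\<lambda>t x. 0"]) (auto intro: assms)
qed

lemma C2_stripD:
  assumes "C2_strip \<infinity> f"
  shows "C1_strip \<infinity> f" "C1_strip \<infinity> (Dt f)" "C1_strip \<infinity> (Dx f)"
  using assms by (auto simp: C2_strip_def)

lemma C2_strip_add:
  assumes f: "C2_strip \<infinity> f" and f': "C2_strip \<infinity> f'"
  shows "C2_strip \<infinity> (\<lambda>t x. f t x + f' t x)"
  unfolding C2_strip_def
proof (intro conjI)
  note D = C2_stripD[OF f] C2_stripD[OF f']
  show "C1_strip \<infinity> (\<lambda>t x. f t x + f' t x)" by (intro C1_strip_add D)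
  show "C1_strip \<infinity> (Dt (\<lambda>t x. f t x + f' t x))"
    by (rule C1_strip_cong[where f = "\<lambda>t x. Dt f t x + Dt f' t x"])
       (auto simp: Dt_add D intro!: C1_strip_add D)
  show "C1_strip \<infinity> (Dx (\<lambda>t x. f t x + f' t x))"
    by (rule C1_strip_cong[where f = "\<lambda>t x. Dx f t x + Dx f' t x"])
       (auto simp: Dx_add D intro!: C1_strip_add D)
qed

lemma C2_strip_mult:
  assumes f: "C2_strip \<infinity> f" and f': "C2_strip \<infinity> f'"
  shows "C2_strip \<infinity> (\<lambda>t x. f t x * f' t x)"
  unfolding C2_strip_def
proof (intro conjI)
  note D = C2_stripD[OF f] C2_stripD[OF f']
  show "C1_strip \<infinity> (\<lambda>t x. f t x * f' t x)" by (intro C1_strip_mult D)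
  show "C1_strip \<infinity> (Dt (\<lambda>t x. f t x * f' t x))"
    by (rule C1_strip_cong[where f = "\<lambda>t x. Dt f t x * f' t x + f t x * Dt f' t x"])
       (auto simp: Dt_mult D intro!: C1_strip_add C1_strip_mult D)
  show "C1_strip \<infinity> (Dx (\<lambda>t x. f t x * f' t x))"
    by (rule C1_strip_cong[where f = "\<lambda>t x. Dx f t x * f' t x + f t x * Dx f' t x"])
       (auto simp: Dx_mult D intro!: C1_strip_add C1_strip_mult D)
qed

lemma C2_stripI:
  assumes "C1_strip \<infinity> f" "C1_strip \<infinity> ft" "C1_strip \<infinity> fx"
    and "\<And>t x. t \<ge> 0 \<Longrightarrow> Dt f t x = ft t x" "\<And>t x. t \<ge> 0 \<Longrightarrow> Dx f t x = fx t x"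
  shows "C2_strip \<infinity> f"
  unfolding C2_strip_def using assms
  by (auto intro: C1_strip_cong[of ft] C1_strip_cong[of fx])

lemma C2_strip_affine_time: "C2_strip \<infinity> (\<lambda>t x. c + d * t)"
proof (rule C2_stripI[where ft = "\<lambda>t x. d" and fx = "\<lambda>t x. 0"])
  show "C1_strip \<infinity> (\<lambda>t x. c + d * t)"
    by (rule C1_strip_time_fun[where q' = "\<lambda>_. d"]) (auto intro!: derivative_eq_intros)
  show "C1_strip \<infinity> (\<lambda>t x. e)" for e
    by (rule C1_strip_time_fun[where q' = "\<lambda>_. 0"]) (auto intro!: derivative_eq_intros)
  show "C1_strip \<infinity> (\<lambda>t x. e)" for e
    by (rule C1_strip_time_fun[where q' = "\<lambda>_. 0"]) (auto intro!: derivative_eq_intros)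
qed (auto intro!: Dt_eq Dx_eq derivative_eq_intros)

subsection \<open>The cutoff functions\<close>

text \<open>At the corner \<open>z = 0\<close> the difference quotient is bounded by
  \<open>max 0 y ^ (n - 1)\<close>, which tends to 0 because \<open>n \<ge> 2\<close>; elsewhere the
  function is locally a power or zero.\<close>

lemma has_real_derivative_max_0_power:
  assumes "n \<ge> 2"
  shows "((\<lambda>z. max 0 z ^ n) has_real_derivative real n * max 0 z ^ (n - 1)) (at z)"
proof -
  consider "z > 0" | "z < 0" | "z = 0" by linarith
  then show ?thesis
  proof cases
    case 1
    have "((\<lambda>z. z ^ n) has_real_derivative real n * max 0 z ^ (n - 1)) (at z)"
      using 1 by (auto intro!: derivative_eq_intros)
    then show ?thesis
      by (rule DERIV_cong_ev[THEN iffD1, OF refl _ refl, rotated])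
         (use 1 eventually_nhds_in_open[of "{0<..}" z] in \<open>auto elim!: eventually_mono\<close>)
  next
    case 2
    have "((\<lambda>z::real. 0) has_real_derivative real n * max 0 z ^ (n - 1)) (at z)"
      using 2 assms by (simp add: power_0_left)
    then show ?thesis
      by (rule DERIV_cong_ev[THEN iffD1, OF refl _ refl, rotated])
         (use 2 assms eventually_nhds_in_open[of "{..<0}" z] in \<open>auto elim!: eventually_mono\<close>)
  next
    case 3
    have "((\<lambda>y. max 0 y ^ n / y) \<longlongrightarrow> 0) (at (0::real))"
    proof (rule tendsto_rabs_zero_cancel, rule tendsto_sandwich[where f = "\<lambda>_. 0" and h = "\<lambda>y. max 0 y ^ (n - 1)"])
      have "((\<lambda>y. max 0 y ^ (n - 1)) \<longlongrightarrow> max 0 0 ^ (n - 1)) (at (0::real))"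
        by (intro tendsto_intros)
      then show "((\<lambda>y. max 0 y ^ (n - 1)) \<longlongrightarrow> 0) (at (0::real))"
        using assms by (simp add: power_0_left)
      have "\<bar>max 0 y ^ n / y\<bar> \<le> max 0 y ^ (n - 1)" for y :: real
        using assms by (cases "y > 0") (auto simp: max_def power_diff power_0_left)
      then show "\<forall>\<^sub>F y in at (0::real). \<bar>max 0 y ^ n / y\<bar> \<le> max 0 y ^ (n - 1)"
        by auto
    qed auto
    then show ?thesis
      using 3 assms by (auto simp: has_field_derivative_iff power_0_left)
  qed
qed

text \<open>The base is kept apart from its exponent because derivatives of
  \<open>bump R t x ^ m\<close> are polynomials times lower powers of the same base, and Young's
  inequality later compares such powers.\<close>

definition bump :: "real \<Rightarrow> real \<Rightarrow> real \<Rightarrow> real" where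
  "bump R t x = max 0 (1 - (t\<^sup>2 + x\<^sup>2) / R\<^sup>2)"

lemma bump_nonneg [simp]: "bump R t x \<ge> 0"
  and bump_le_1 [simp]: "bump R t x \<le> 1"
  by (auto simp: bump_def)

lemma bump_eq_0_iff:
  assumes "R > 0"
  shows "bump R t x = 0 \<longleftrightarrow> R\<^sup>2 \<le> t\<^sup>2 + x\<^sup>2"
  using assms by (auto simp: bump_def max_def field_simps)

lemma bump_pos_bounds:
  assumes "R > 0" "bump R t x \<noteq> 0"
  shows "\<bar>t\<bar> \<le> R" "\<bar>x\<bar> \<le> R" "t\<^sup>2 \<le> R\<^sup>2" "x\<^sup>2 \<le> R\<^sup>2"
proof -
  have "t\<^sup>2 + x\<^sup>2 < R\<^sup>2" using assms bump_eq_0_iff by force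
  then show *: "t\<^sup>2 \<le> R\<^sup>2" "x\<^sup>2 \<le> R\<^sup>2"
    using zero_le_power2[of t] zero_le_power2[of x] by linarith+
  show "\<bar>t\<bar> \<le> R" "\<bar>x\<bar> \<le> R"
    using * assms(1) by (metis abs_le_square_iff abs_of_pos)+
qed

lemma continuous_on_bump: "continuous_on S (\<lambda>z. bump R (fst z) (snd z))"
  unfolding bump_def by (cases "R = 0") (auto intro!: continuous_intros)

lemma bump_power_derivative:
  assumes "m \<ge> 2"
  shows "((\<lambda>s. bump R s x ^ m) has_real_derivative - (2 * real m * t / R\<^sup>2) * bump R t x ^ (m - 1)) (at t)"
    and "((\<lambda>y. bump R t y ^ m) has_real_derivative - (2 * real m * x / R\<^sup>2) * bump R t x ^ (m - 1)) (at x)"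
proof -
  \<comment> \<open>The free factor \<open>k\<close> stands for \<open>inverse (R\<^sup>2)\<close>.
    Multiplying instead of dividing also covers \<open>R = 0\<close>, where division gives the
    default value 0.\<close>
  have "((\<lambda>s. 1 - (s\<^sup>2 + c) * k) has_real_derivative - (2 * r) * k) (at r)"
    "((\<lambda>s. 1 - (c + s\<^sup>2) * k) has_real_derivative - (2 * r) * k) (at r)" for c r k :: real
    by (auto intro!: derivative_eq_intros)
  from this[where k = "inverse (R\<^sup>2)"]
  have d: "((\<lambda>s. 1 - (s\<^sup>2 + c) / R\<^sup>2) has_real_derivative - (2 * r) / R\<^sup>2) (at r)"
    "((\<lambda>s. 1 - (c + s\<^sup>2) / R\<^sup>2) has_real_derivative - (2 * r) / R\<^sup>2) (at r)" for c r
    by (simp_all add: divide_inverse)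
  show "((\<lambda>s. bump R s x ^ m) has_real_derivative - (2 * real m * t / R\<^sup>2) * bump R t x ^ (m - 1)) (at t)"
    unfolding bump_def
    using DERIV_chain2[where f = "\<lambda>z. max 0 z ^ m" and g = "\<lambda>s. 1 - (s\<^sup>2 + x\<^sup>2) / R\<^sup>2",
        OF has_real_derivative_max_0_power[OF assms] d(1)] by (simp add: mult_ac)
  show "((\<lambda>y. bump R t y ^ m) has_real_derivative - (2 * real m * x / R\<^sup>2) * bump R t x ^ (m - 1)) (at x)"
    unfolding bump_def
    using DERIV_chain2[where f = "\<lambda>z. max 0 z ^ m" and g = "\<lambda>s. 1 - (t\<^sup>2 + s\<^sup>2) / R\<^sup>2",
        OF has_real_derivative_max_0_power[OF assms] d(2)] by (simp add: mult_ac)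
qed

lemma Dt_bump_power:
  assumes "m \<ge> 2" "t \<ge> 0"
  shows "Dt (\<lambda>t x. bump R t x ^ m) t x = - (2 * real m * t / R\<^sup>2) * bump R t x ^ (m - 1)"
  by (rule Dt_eq[where f = "\<lambda>t x. bump R t x ^ m", OF assms(2)
        has_field_derivative_at_within[OF bump_power_derivative(1)[OF assms(1)]]])

lemma Dx_bump_power:
  assumes "m \<ge> 2"
  shows "Dx (\<lambda>t x. bump R t x ^ m) t x = - (2 * real m * x / R\<^sup>2) * bump R t x ^ (m - 1)"
  using assms by (intro Dx_eq bump_power_derivative)

lemma C1_strip_bump_power:
  assumes "m \<ge> 2"
  shows "C1_strip \<infinity> (\<lambda>t x. bump R t x ^ m)"
proof (rule C1_stripI[where ft = "\<lambda>t x. - (2 * real m * t / R\<^sup>2) * bump R t x ^ (m - 1)"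
      and fx = "\<lambda>t x. - (2 * real m * x / R\<^sup>2) * bump R t x ^ (m - 1)"])
  fix t x :: real
  show "((\<lambda>s. bump R s x ^ m) has_real_derivative - (2 * real m * t / R\<^sup>2) * bump R t x ^ (m - 1))
      (at t within {0..})"
    by (rule has_field_derivative_at_within[OF bump_power_derivative(1)[OF assms]])
  show "((\<lambda>y. bump R t y ^ m) has_real_derivative - (2 * real m * x / R\<^sup>2) * bump R t x ^ (m - 1)) (at x)"
    by (rule bump_power_derivative(2)[OF assms])
qed (auto simp: case_prod_unfold divide_inverse intro!: continuous_intros continuous_on_bump)

lemma C1_strip_linear: "C1_strip \<infinity> (\<lambda>t x. c * t)" "C1_strip \<infinity> (\<lambda>t x. c * x)"
proof -
  show "C1_strip \<infinity> (\<lambda>t x. c * t)"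
    by (rule C1_strip_time_fun[where q' = "\<lambda>_. c"]) (auto intro!: derivative_eq_intros)
  show "C1_strip \<infinity> (\<lambda>t x. c * x)"
    by (rule C1_stripI[where ft = "\<lambda>t x. 0" and fx = "\<lambda>t x. c"])
       (auto intro!: derivative_eq_intros continuous_intros simp: case_prod_unfold)
qed

text \<open>Two derivatives lower the exponent to \<open>m - 2 \<ge> 1\<close>, so the second
  derivatives stay continuous across the circle where the cutoff ends.\<close>

lemma C2_strip_bump_power:
  assumes "m \<ge> 3"
  shows "C2_strip \<infinity> (\<lambda>t x. bump R t x ^ m)"
proof (rule C2_stripI[where ft = "\<lambda>t x. (- (2 * real m / R\<^sup>2) * t) * bump R t x ^ (m - 1)"
      and fx = "\<lambda>t x. (- (2 * real m / R\<^sup>2) * x) * bump R t x ^ (m - 1)"])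
  show "C1_strip \<infinity> (\<lambda>t x. bump R t x ^ m)"
    using assms by (intro C1_strip_bump_power) simp
  show "C1_strip \<infinity> (\<lambda>t x. (- (2 * real m / R\<^sup>2) * t) * bump R t x ^ (m - 1))"
    "C1_strip \<infinity> (\<lambda>t x. (- (2 * real m / R\<^sup>2) * x) * bump R t x ^ (m - 1))"
    using assms by (intro C1_strip_mult C1_strip_linear C1_strip_bump_power; simp)+
qed (use assms in \<open>auto simp: Dt_bump_power Dx_bump_power\<close>)

lemma bump_power_second_derivatives:
  fixes t x R :: real and m :: nat
  assumes m: "m \<ge> 3" and t: "t \<ge> 0"
  shows "Dt (Dt (\<lambda>t x. bump R t x ^ m)) t x =
      - (2 * real m / R\<^sup>2) * bump R t x ^ (m - 1) + 4 * real m * real (m - 1) * t\<^sup>2 / R ^ 4 * bump R t x ^ (m - 2)"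
    and "Dx (Dx (\<lambda>t x. bump R t x ^ m)) t x =
      - (2 * real m / R\<^sup>2) * bump R t x ^ (m - 1) + 4 * real m * real (m - 1) * x\<^sup>2 / R ^ 4 * bump R t x ^ (m - 2)"
proof -
  have m1: "m - 1 \<ge> 2" "m \<ge> 2" and e: "m - 1 - 1 = m - 2" using m by auto
  have "Dt (Dt (\<lambda>t x. bump R t x ^ m)) t x
      = Dt (\<lambda>t x. (- (2 * real m / R\<^sup>2) * t) * bump R t x ^ (m - 1)) t x"
    using t m1 by (intro Dt_cong) (auto simp: Dt_bump_power)
  also have "\<dots> = - (2 * real m / R\<^sup>2) * bump R t x ^ (m - 1)
      + (- (2 * real m / R\<^sup>2) * t) * (- (2 * real (m - 1) * t / R\<^sup>2) * bump R t x ^ (m - 2))"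
    using DERIV_mult[OF DERIV_cmult_Id[of "- (2 * real m / R\<^sup>2)"]
        bump_power_derivative(1)[OF m1(1), of R x t], unfolded e]
    by (intro Dt_eq[OF t] has_field_derivative_at_within[where s = "{0..}"]) (simp add: mult_ac)
  also have "\<dots> = - (2 * real m / R\<^sup>2) * bump R t x ^ (m - 1)
      + 4 * real m * real (m - 1) * t\<^sup>2 / R ^ 4 * bump R t x ^ (m - 2)"
    by (simp add: divide_inverse power2_eq_square power4_eq_xxxx mult_ac)
  finally show "Dt (Dt (\<lambda>t x. bump R t x ^ m)) t x = \<dots>" .
  have "Dx (Dx (\<lambda>t x. bump R t x ^ m)) t x
      = Dx (\<lambda>t x. (- (2 * real m / R\<^sup>2) * x) * bump R t x ^ (m - 1)) t x"
    using t m1 by (intro Dx_cong) (auto simp: Dx_bump_power)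
  also have "\<dots> = - (2 * real m / R\<^sup>2) * bump R t x ^ (m - 1)
      + (- (2 * real m / R\<^sup>2) * x) * (- (2 * real (m - 1) * x / R\<^sup>2) * bump R t x ^ (m - 2))"
    using DERIV_mult[OF DERIV_cmult_Id[of "- (2 * real m / R\<^sup>2)"]
        bump_power_derivative(2)[OF m1(1), of R t x], unfolded e]
    by (intro Dx_eq) (simp add: mult_ac)
  also have "\<dots> = - (2 * real m / R\<^sup>2) * bump R t x ^ (m - 1)
      + 4 * real m * real (m - 1) * x\<^sup>2 / R ^ 4 * bump R t x ^ (m - 2)"
    by (simp add: divide_inverse power2_eq_square power4_eq_xxxx mult_ac)
  finally show "Dx (Dx (\<lambda>t x. bump R t x ^ m)) t x = \<dots>" .
qed

text \<open>The lowest occurring power \<open>Q\<close> dominates the higher ones because the base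
  is at most 1. In the second derivatives \<open>t\<^sup>2\<close> and \<open>x\<^sup>2\<close> are
  at most \<open>R\<^sup>2\<close> wherever the cutoff is nonzero, which reduces the denominator
  \<open>R ^ 4\<close> to \<open>R\<^sup>2\<close>.\<close>

lemma bump_power_derivative_bounds:
  fixes R t x :: real and m :: nat
  assumes m: "m \<ge> 3" and t: "t \<ge> 0" and R: "R > 0"
  defines "\<phi> \<equiv> \<lambda>t x. bump R t x ^ m" and "Q \<equiv> bump R t x ^ (m - 2)"
  shows "\<bar>Dt \<phi> t x\<bar> \<le> 2 * real m * t / R\<^sup>2 * Q" "\<bar>Dx \<phi> t x\<bar> \<le> 2 * real m * \<bar>x\<bar> / R\<^sup>2 * Q"
    "\<bar>Dt (Dt \<phi>) t x\<bar> \<le> 6 * (real m)\<^sup>2 / R\<^sup>2 * Q" "\<bar>Dx (Dx \<phi>) t x\<bar> \<le> 6 * (real m)\<^sup>2 / R\<^sup>2 * Q"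
proof -
  have m2: "m \<ge> 2" using m by simp
  have Q: "bump R t x ^ (m - 1) \<le> Q" "0 \<le> bump R t x ^ (m - 1)"
    unfolding Q_def by (auto intro!: power_decreasing)
  have Q0: "Q \<ge> 0" by (simp add: Q_def)
  show "\<bar>Dt \<phi> t x\<bar> \<le> 2 * real m * t / R\<^sup>2 * Q"
    unfolding \<phi>_def Dt_bump_power[OF m2 t] using t Q by (simp add: abs_mult divide_right_mono mult_left_mono)
  show "\<bar>Dx \<phi> t x\<bar> \<le> 2 * real m * \<bar>x\<bar> / R\<^sup>2 * Q"
    unfolding \<phi>_def Dx_bump_power[OF m2] using Q by (simp add: abs_mult divide_right_mono mult_left_mono)
  \<comment> \<open>One estimate serves both second derivatives, with \<open>y\<close> equal to
    \<open>t\<close> or \<open>x\<close>. Its premise is conditional on \<open>Q \<noteq> 0\<close>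
    since \<open>y\<close> is unbounded off the support; there both terms vanish.\<close>
  have key: "\<bar>- (2 * real m / R\<^sup>2) * bump R t x ^ (m - 1) + 4 * real m * real (m - 1) * y\<^sup>2 / R ^ 4 * bump R t x ^ (m - 2)\<bar>
      \<le> 6 * (real m)\<^sup>2 / R\<^sup>2 * Q" (is "\<bar>?A + ?B\<bar> \<le> _")
    if "Q \<noteq> 0 \<Longrightarrow> y\<^sup>2 \<le> R\<^sup>2" for y
  proof (cases "Q = 0")
    case True
    then have "bump R t x = 0" by (simp add: Q_def)
    then show ?thesis using m by (simp add: Q_def power_0_left)
  next
    case False
    have mm: "real m \<le> real m * real m" "real m * real (m - 1) \<le> real m * real m"
      using m by (auto intro!: mult_left_mono)
    have "\<bar>?A\<bar> = 2 * real m / R\<^sup>2 * bump R t x ^ (m - 1)" using Q by (simp add: abs_mult)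
    also have "\<dots> \<le> 2 * real m / R\<^sup>2 * Q" using Q by (intro mult_left_mono) auto
    also have "\<dots> \<le> 2 * (real m)\<^sup>2 / R\<^sup>2 * Q"
      using mm Q0 by (intro mult_right_mono divide_right_mono) (auto simp: power2_eq_square)
    finally have A: "\<bar>?A\<bar> \<le> 2 * (real m)\<^sup>2 / R\<^sup>2 * Q" .
    have "\<bar>?B\<bar> = 4 * (real m * real (m - 1)) * (y\<^sup>2 / R\<^sup>2) / R\<^sup>2 * Q"
      using Q0 by (simp add: Q_def flip: power_add)
    also have "\<dots> \<le> 4 * (real m)\<^sup>2 * 1 / R\<^sup>2 * Q"
      using that[OF False] mm Q0 R
      by (intro mult_right_mono divide_right_mono mult_mono) (auto simp: power2_eq_square)
    finally have B: "\<bar>?B\<bar> \<le> 4 * (real m)\<^sup>2 / R\<^sup>2 * Q" by simp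
    have "\<bar>?A + ?B\<bar> \<le> 2 * (real m)\<^sup>2 / R\<^sup>2 * Q + 4 * (real m)\<^sup>2 / R\<^sup>2 * Q"
      by (rule order_trans[OF abs_triangle_ineq add_mono[OF A B]])
    also have "\<dots> = 6 * (real m)\<^sup>2 / R\<^sup>2 * Q" by (simp add: field_simps)
    finally show ?thesis .
  qed
  have "Q \<noteq> 0 \<Longrightarrow> t\<^sup>2 \<le> R\<^sup>2" "Q \<noteq> 0 \<Longrightarrow> x\<^sup>2 \<le> R\<^sup>2"
    using bump_pos_bounds[OF R, of t x] m by (auto simp: Q_def)
  then show "\<bar>Dt (Dt \<phi>) t x\<bar> \<le> 6 * (real m)\<^sup>2 / R\<^sup>2 * Q" "\<bar>Dx (Dx \<phi>) t x\<bar> \<le> 6 * (real m)\<^sup>2 / R\<^sup>2 * Q"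
    unfolding \<phi>_def bump_power_second_derivatives[OF m t] by (intro key; simp)+
qed

section \<open>Test functions and the adjoint operator\<close>

lemma C2_compact_support_mult_bump_power:
  assumes "C2_strip \<infinity> g" "m \<ge> 3" "R > 0"
  shows "C2_compact_support \<infinity> (\<lambda>t x. g t x * bump R t x ^ m)"
  unfolding C2_compact_support_def
proof (intro conjI exI)
  show "C2_strip \<infinity> (\<lambda>t x. g t x * bump R t x ^ m)"
    by (intro C2_strip_mult assms C2_strip_bump_power)
  show "compact (cball 0 R \<inter> {0::real..} \<times> (UNIV :: real set))"
    by (intro compact_Int_closed compact_cball closed_Times closed_UNIV closed_atLeast)
  have "bump R t x = 0" if "(t, x) \<notin> cball 0 R" for t x
  proof -
    have "R < sqrt (t\<^sup>2 + x\<^sup>2)" using that by (simp add: norm_Pair)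
    then have "R\<^sup>2 \<le> (sqrt (t\<^sup>2 + x\<^sup>2))\<^sup>2"
      using \<open>R > 0\<close> by (intro power_mono) auto
    then show ?thesis
      using \<open>R > 0\<close> by (simp add: bump_eq_0_iff)
  qed
  then show "\<forall>t\<in>time_set \<infinity>. \<forall>x. (t, x) \<notin> cball 0 R \<inter> {0..} \<times> UNIV \<longrightarrow> g t x * bump R t x ^ m = 0"
    using assms(2) by auto
qed auto

text \<open>The product rule, sorted so that the adjoint operator on \<open>g\<close> becomes the
  coefficient of \<open>\<phi>\<close>. When \<open>g\<close> solves the adjoint equation, every
  remaining term contains a derivative of \<open>\<phi>\<close>.\<close>

lemma adjoint_operator_mult:
  assumes g: "C2_strip \<infinity> g" and \<phi>: "C2_strip \<infinity> \<phi>" and a: "C1_strip \<infinity> a" and t: "t \<ge> 0"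
  defines "\<psi> \<equiv> \<lambda>t x. g t x * \<phi> t x"
  shows "Dt (Dt \<psi>) t x - Dx (Dx \<psi>) t x - Dt (\<lambda>s y. a s y * \<psi> s y) t x =
    (Dt (Dt g) t x - Dx (Dx g) t x - Dt (\<lambda>s y. a s y * g s y) t x) * \<phi> t x
    + 2 * Dt g t x * Dt \<phi> t x + g t x * Dt (Dt \<phi>) t x
    - 2 * Dx g t x * Dx \<phi> t x - g t x * Dx (Dx \<phi>) t x - a t x * g t x * Dt \<phi> t x"
proof -
  note D = C2_stripD[OF g] C2_stripD[OF \<phi>] a C1_strip_mult C1_strip_add
  have 1: "Dt (Dt \<psi>) t x = Dt (\<lambda>t x. Dt g t x * \<phi> t x + g t x * Dt \<phi> t x) t x"
    unfolding \<psi>_def by (intro Dt_cong Dt_mult D t)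
  have 2: "Dx (Dx \<psi>) t x = Dx (\<lambda>t x. Dx g t x * \<phi> t x + g t x * Dx \<phi> t x) t x"
    unfolding \<psi>_def by (intro Dx_cong Dx_mult D t)
  show ?thesis
    unfolding 1 2 by (simp add: \<psi>_def Dt_mult Dt_add Dx_mult Dx_add D t algebra_simps)
qed

text \<open>By \<open>eq\<close> only terms with a differentiated cutoff survive. A first derivative
  costs \<open>t\<close> or \<open>\<bar>x\<bar>\<close> over \<open>R\<^sup>2\<close> and meets the
  bounded factors \<open>Dt g\<close>, \<open>Dx g\<close> and \<open>a g\<close>; a second
  derivative costs \<open>1 / R\<^sup>2\<close> and meets \<open>g\<close>, of size
  \<open>1 + t\<close>.\<close>

lemma adjoint_cutoff_bound:
  assumes g: "C2_strip \<infinity> g" and a: "C1_strip \<infinity> a"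
    and eq: "Dt (Dt g) t x - Dx (Dx g) t x - Dt (\<lambda>s y. a s y * g s y) t x = 0"
    and G: "\<bar>Dt g t x\<bar> \<le> G" "\<bar>Dx g t x\<bar> \<le> G" "\<bar>a t x * g t x\<bar> \<le> G" "\<bar>g t x\<bar> \<le> G * (1 + t)"
    and m: "m \<ge> 3" and t: "t \<ge> 0" and R: "R > 0"
  defines "\<psi> \<equiv> \<lambda>t x. g t x * bump R t x ^ m"
  shows "\<bar>Dt (Dt \<psi>) t x - Dx (Dx \<psi>) t x - Dt (\<lambda>s y. a s y * \<psi> s y) t x\<bar>
    \<le> 18 * G * (real m)\<^sup>2 * (1 + t + \<bar>x\<bar>) / R\<^sup>2 * bump R t x ^ (m - 2)"
proof -
  define \<phi> where "\<phi> = (\<lambda>t x. bump R t x ^ m)"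
  define Q where "Q = bump R t x ^ (m - 2) / R\<^sup>2"
  have Q0: "Q \<ge> 0" by (simp add: Q_def)
  have G0: "G \<ge> 0" using G(1) by linarith
  have B: "\<bar>Dt \<phi> t x\<bar> \<le> 2 * real m * t * Q" "\<bar>Dx \<phi> t x\<bar> \<le> 2 * real m * \<bar>x\<bar> * Q"
    "\<bar>Dt (Dt \<phi>) t x\<bar> \<le> 6 * (real m)\<^sup>2 * Q" "\<bar>Dx (Dx \<phi>) t x\<bar> \<le> 6 * (real m)\<^sup>2 * Q"
    using bump_power_derivative_bounds[OF m t R, of x] by (auto simp: \<phi>_def Q_def)
  have b1: "\<bar>Dt g t x * Dt \<phi> t x\<bar> \<le> G * (2 * real m * t * Q)"
    unfolding abs_mult by (intro mult_mono G B G0) auto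
  have b2: "\<bar>g t x * Dt (Dt \<phi>) t x\<bar> \<le> (G * (1 + t)) * (6 * (real m)\<^sup>2 * Q)"
    unfolding abs_mult using G0 t by (intro mult_mono G B) auto
  have b3: "\<bar>Dx g t x * Dx \<phi> t x\<bar> \<le> G * (2 * real m * \<bar>x\<bar> * Q)"
    unfolding abs_mult by (intro mult_mono G B G0) auto
  have b4: "\<bar>g t x * Dx (Dx \<phi>) t x\<bar> \<le> (G * (1 + t)) * (6 * (real m)\<^sup>2 * Q)"
    unfolding abs_mult using G0 t by (intro mult_mono G B) auto
  have b5: "\<bar>a t x * g t x * Dt \<phi> t x\<bar> \<le> G * (2 * real m * t * Q)"
    unfolding abs_mult[of "a t x * g t x"] by (intro mult_mono G B G0) auto
  have mm: "real m \<le> real m * real m" using m by auto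
  have "\<bar>Dt (Dt \<psi>) t x - Dx (Dx \<psi>) t x - Dt (\<lambda>s y. a s y * \<psi> s y) t x\<bar>
      = \<bar>2 * Dt g t x * Dt \<phi> t x + g t x * Dt (Dt \<phi>) t x
    - 2 * Dx g t x * Dx \<phi> t x - g t x * Dx (Dx \<phi>) t x - a t x * g t x * Dt \<phi> t x\<bar>"
    unfolding \<psi>_def \<phi>_def adjoint_operator_mult[OF g C2_strip_bump_power[OF m] a t] eq by simp
  also have "\<dots> \<le> 2 * (G * (2 * real m * t * Q)) + (G * (1 + t)) * (6 * (real m)\<^sup>2 * Q)
      + 2 * (G * (2 * real m * \<bar>x\<bar> * Q)) + (G * (1 + t)) * (6 * (real m)\<^sup>2 * Q) + G * (2 * real m * t * Q)"
    using b1 b2 b3 b4 b5 by linarith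
  also have "\<dots> = G * Q * (6 * t * real m + 12 * (1 + t) * (real m)\<^sup>2 + 4 * \<bar>x\<bar> * real m)"
    by (simp add: algebra_simps)
  also have "\<dots> \<le> G * Q * (6 * t * (real m)\<^sup>2 + 12 * (1 + t) * (real m)\<^sup>2 + 4 * \<bar>x\<bar> * (real m)\<^sup>2)"
    using mm t G0 Q0 by (intro mult_left_mono add_mono) (auto simp: power2_eq_square)
  also have "\<dots> = G * Q * (real m)\<^sup>2 * (12 + 18 * t + 4 * \<bar>x\<bar>)"
    by (simp add: algebra_simps)
  \<comment> \<open>The constant 18 is the coefficient of \<open>t\<close>: 6 from the first-order
    terms and 12 from the second-order ones.\<close>
  also have "\<dots> \<le> G * Q * (real m)\<^sup>2 * (18 * (1 + t + \<bar>x\<bar>))"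
    using G0 Q0 t by (intro mult_left_mono) auto
  also have "G * Q * (real m)\<^sup>2 * (18 * s) = 18 * G * (real m)\<^sup>2 * s / R\<^sup>2 * bump R t x ^ (m - 2)" for s
    by (simp add: Q_def)
  finally show ?thesis .
qed

subsection \<open>Integral estimates\<close>

text \<open>The integrand is the derivative of \<open>- ((1 - s\<^sup>2 / R\<^sup>2) ^ m)\<close>,
  whose value at \<open>s = R\<close> vanishes because \<open>m \<ge> 1\<close>. For
  \<open>r = 0\<close> the integral is 1, so the weight is a probability density on
  \<open>{0..R}\<close>.\<close>

lemma integral_bump_weight:
  assumes "0 \<le> r" "r \<le> R" "R > 0" "m \<ge> 1"
  shows "(LINT s|lborel. indicator {r..R} s * (2 * real m * s / R\<^sup>2 * (1 - s\<^sup>2 / R\<^sup>2) ^ (m - 1)))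
    = (1 - r\<^sup>2 / R\<^sup>2) ^ m" (is "?I = _")
proof -
  let ?w = "\<lambda>s. 2 * real m * s / R\<^sup>2 * (1 - s\<^sup>2 / R\<^sup>2) ^ (m - 1)"
  have "((\<lambda>s. - ((1 - s\<^sup>2 * d) ^ m)) has_real_derivative
      2 * real m * s * d * (1 - s\<^sup>2 * d) ^ (m - 1)) (at s)" for s d
    by (auto intro!: derivative_eq_intros)
  from this[where d = "inverse (R\<^sup>2)"]
  have "((\<lambda>s. - ((1 - s\<^sup>2 / R\<^sup>2) ^ m)) has_real_derivative ?w s) (at s)" for s
    unfolding divide_inverse .
  from has_field_derivative_at_within[OF this]
  have "(LINT s|lborel. indicator {r..R} s *\<^sub>R ?w s)
      = - ((1 - R\<^sup>2 / R\<^sup>2) ^ m) - - ((1 - r\<^sup>2 / R\<^sup>2) ^ m)"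
    using assms
    by (intro integral_FTC_atLeastAtMost)
       (auto simp flip: has_real_derivative_iff_has_vector_derivative intro!: continuous_intros)
  then show ?thesis using assms by (simp add: power_0_left)
qed

text \<open>The profile \<open>(1 - x\<^sup>2 / R\<^sup>2)\<^sup>m\<close> is a superposition of the indicators of \<open>[-r, r]\<close>, \<open>0 \<le> r \<le> R\<close>,
  with a positive weight.\<close>

lemma integral_mult_bump_power:
  fixes f :: "real \<Rightarrow> real"
  assumes f: "f \<in> borel_measurable lborel" and int: "integrable lborel (\<lambda>x. f x * bump R 0 x ^ m)"
    and R: "R > 0" and m: "m \<ge> 1"
  defines "w \<equiv> \<lambda>r. indicator {0..R} r * (2 * real m * r / R\<^sup>2 * (1 - r\<^sup>2 / R\<^sup>2) ^ (m - 1))"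
  shows "integrable lborel (\<lambda>r. w r * (LINT x:{-r..r}|lborel. f x))"
    and "(LINT x|lborel. f x * bump R 0 x ^ m) = (LINT r|lborel. w r * (LINT x:{-r..r}|lborel. f x))"
proof -
  have w_nonneg: "w r \<ge> 0" for r
    using R by (auto simp: w_def indicator_def divide_simps power_mono intro!: mult_nonneg_nonneg)
  \<comment> \<open>Fubini for \<open>F\<close>: integrating over \<open>r\<close> first produces
    the profile \<open>bump R 0 x ^ m\<close>, integrating over \<open>x\<close> first produces the
    sharply truncated integrals of \<open>f\<close>.\<close>
  define F where "F = (\<lambda>x r. f x * ((if \<bar>x\<bar> \<le> r then 1 else 0) * w r))"
  have wm: "w \<in> borel_measurable lborel" unfolding w_def by measurable
  have Fm: "case_prod F \<in> borel_measurable (lborel \<Otimes>\<^sub>M lborel)"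
    using f wm unfolding F_def by measurable
  have inner: "(LINT r|lborel. (if \<bar>x\<bar> \<le> r then 1 else 0) * w r) = bump R 0 x ^ m"
    "integrable lborel (\<lambda>r. (if \<bar>x\<bar> \<le> r then 1 else 0) * w r)" for x
  proof -
    have eq: "(if \<bar>x\<bar> \<le> r then 1 else 0) * w r
        = indicator {\<bar>x\<bar>..R} r * (2 * real m * r / R\<^sup>2 * (1 - r\<^sup>2 / R\<^sup>2) ^ (m - 1))" for r
      by (auto simp: w_def indicator_def)
    have "set_integrable lborel {\<bar>x\<bar>..R} (\<lambda>r. 2 * real m * r / R\<^sup>2 * (1 - r\<^sup>2 / R\<^sup>2) ^ (m - 1))"
      using R by (intro borel_integrable_atLeastAtMost') (auto intro!: continuous_intros)
    then show "integrable lborel (\<lambda>r. (if \<bar>x\<bar> \<le> r then 1 else 0) * w r)"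
      unfolding eq by (simp add: set_integrable_def)
    show "(LINT r|lborel. (if \<bar>x\<bar> \<le> r then 1 else 0) * w r) = bump R 0 x ^ m"
    proof (cases "\<bar>x\<bar> \<le> R")
      case True
      then have "x\<^sup>2 \<le> R\<^sup>2" using R by (metis abs_le_square_iff abs_of_pos)
      then show ?thesis
        unfolding eq using integral_bump_weight[of "\<bar>x\<bar>" R m] True R m
        by (simp add: bump_def)
    next
      case False
      then have "\<bar>R\<bar> \<le> \<bar>x\<bar>" using R by linarith
      then have "R\<^sup>2 \<le> x\<^sup>2" by (simp only: abs_le_square_iff)
      then have "bump R 0 x = 0" using R bump_eq_0_iff[of R 0 x] by simp
      then show ?thesis unfolding eq using False m by (simp add: power_0_left)
    qed
  qed
  have "integrable (lborel \<Otimes>\<^sub>M lborel) (case_prod F)"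
  proof (rule lborel_pair.Fubini_integrable[OF Fm])
    \<comment> \<open>As \<open>w\<close> is nonnegative, the inner integral of the absolute value
      is again a multiple of the profile, and its integrability in \<open>x\<close> is the
      hypothesis \<open>int\<close>.\<close>
    have "(LINT r|lborel. norm (case_prod F (x, r))) = \<bar>f x * bump R 0 x ^ m\<bar>" for x
    proof -
      have "norm (case_prod F (x, r)) = \<bar>f x\<bar> * ((if \<bar>x\<bar> \<le> r then 1 else 0) * w r)" for r
        using w_nonneg by (simp add: F_def abs_mult)
      then show ?thesis by (simp add: inner abs_mult)
    qed
    then show "integrable lborel (\<lambda>x. LINT r|lborel. norm (case_prod F (x, r)))"
      using int by simp
    show "AE x in lborel. integrable lborel (\<lambda>r. case_prod F (x, r))"
      using inner(2) by (auto simp: F_def)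
  qed
  note I = lborel_pair.integrable_snd[OF this] lborel_pair.Fubini_integral[OF this]
  have Fr: "(LINT x|lborel. F x r) = w r * (LINT x:{-r..r}|lborel. f x)" for r
  proof -
    have "F x r = w r * (indicator {-r..r} x * f x)" for x
      by (auto simp: F_def indicator_def)
    then show ?thesis by (simp add: set_lebesgue_integral_def)
  qed
  show "integrable lborel (\<lambda>r. w r * (LINT x:{-r..r}|lborel. f x))"
    using I(1) unfolding Fr .
  have "(LINT r|lborel. F x r) = f x * bump R 0 x ^ m" for x
    using inner(1) by (simp add: F_def)
  then show "(LINT x|lborel. f x * bump R 0 x ^ m) = (LINT r|lborel. w r * (LINT x:{-r..r}|lborel. f x))"
    using I(2) unfolding Fr by simp
qed

text \<open>Since \<open>f\<close> may fail to be integrable on the whole line, the bound is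
  transferred from sharp truncations by averaging over \<open>r\<close>. Radii
  \<open>r \<ge> \<rho>\<close> contribute at least \<open>c\<close>; radii below
  \<open>\<rho>\<close> contribute at least \<open>- B\<close>, and their share
  \<open>1 - (1 - \<rho>\<^sup>2 / R\<^sup>2) ^ m\<close> of the weight tends to 0.\<close>

lemma integral_mult_bump_power_lower_bound:
  fixes f :: "real \<Rightarrow> real"
  assumes f: "f \<in> borel_measurable lborel"
    and int: "\<And>R. R > 0 \<Longrightarrow> integrable lborel (\<lambda>x. f x * bump R 0 x ^ m)"
    and m: "m \<ge> 1" and \<rho>: "\<rho> > 0" and c: "c > 0"
    and lower: "\<And>r. r \<ge> \<rho> \<Longrightarrow> (LINT x:{-r..r}|lborel. f x) \<ge> c"
  shows "\<forall>\<^sub>F R in at_top. (LINT x|lborel. f x * bump R 0 x ^ m) \<ge> c / 2"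
proof -
  \<comment> \<open>On \<open>\<bar>x\<bar> \<le> \<rho>\<close> the base of radius
    \<open>2 * \<rho>\<close> is at least 3/4, so the factor \<open>(4/3) ^ m\<close> lets this one
    integral dominate every truncation with \<open>r \<le> \<rho>\<close>.\<close>
  define B where "B = (LINT x|lborel. \<bar>f x * bump (2 * \<rho>) 0 x ^ m\<bar>) * (4/3) ^ m"
  have Bl: "\<bar>LINT x:{-r..r}|lborel. f x\<bar> \<le> B" if "r \<le> \<rho>" for r
  proof -
    have "\<bar>LINT x:{-r..r}|lborel. f x\<bar> \<le> (LINT x|lborel. norm (indicator {-r..r} x *\<^sub>R f x))"
      unfolding set_lebesgue_integral_def using integral_norm_bound by (metis real_norm_def)
    also have "\<dots> \<le> (LINT x|lborel. \<bar>f x * bump (2 * \<rho>) 0 x ^ m\<bar> * (4/3) ^ m)"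
    proof (rule integral_mono')
      show "integrable lborel (\<lambda>x. \<bar>f x * bump (2 * \<rho>) 0 x ^ m\<bar> * (4/3) ^ m)"
        using int[of "2 * \<rho>"] \<rho> by (intro integrable_mult_left integrable_abs) auto
      fix x
      show "norm (indicator {-r..r} x *\<^sub>R f x) \<le> \<bar>f x * bump (2 * \<rho>) 0 x ^ m\<bar> * (4/3) ^ m"
      proof (cases "x \<in> {-r..r}")
        case True
        then have "\<bar>x\<bar> \<le> \<bar>\<rho>\<bar>" using that by auto
        then have "x\<^sup>2 \<le> \<rho>\<^sup>2" by (simp only: abs_le_square_iff)
        then have "3/4 \<le> 1 - x\<^sup>2 / (2 * \<rho>)\<^sup>2"
          using \<rho> by (simp add: field_simps)
        then have "3/4 \<le> bump (2 * \<rho>) 0 x" by (simp add: bump_def)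
        then have "1 ^ m \<le> (bump (2 * \<rho>) 0 x * (4/3)) ^ m"
          by (intro power_mono) auto
        then have "\<bar>f x\<bar> * 1 \<le> \<bar>f x\<bar> * (bump (2 * \<rho>) 0 x ^ m * (4/3) ^ m)"
          unfolding power_mult_distrib by (intro mult_left_mono) auto
        then show ?thesis using True by (simp add: abs_mult mult_ac)
      qed auto
    qed auto
    finally show ?thesis by (simp add: B_def)
  qed
  have lim: "((\<lambda>R. c - (B + c) * (1 - (1 - \<rho>\<^sup>2 / R\<^sup>2) ^ m)) \<longlongrightarrow> c - (B + c) * (1 - (1 - 0) ^ m)) at_top"
  proof -
    have "((\<lambda>R. \<rho>\<^sup>2 / R\<^sup>2) \<longlongrightarrow> 0) at_top"
      by (intro real_tendsto_divide_at_top tendsto_const filterlim_pow_at_top filterlim_ident) auto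
    then show ?thesis by (intro tendsto_intros)
  qed
  then have "\<forall>\<^sub>F R in at_top. c - (B + c) * (1 - (1 - \<rho>\<^sup>2 / R\<^sup>2) ^ m) > c / 2"
    by (rule order_tendstoD) (use c in auto)
  with eventually_ge_at_top[of \<rho>] show ?thesis
  proof eventually_elim
    case (elim R)
    have R: "R > 0" using elim \<rho> by linarith
    define w0 where "w0 = (\<lambda>r. 2 * real m * r / R\<^sup>2 * (1 - r\<^sup>2 / R\<^sup>2) ^ (m - 1))"
    let ?w = "\<lambda>r. indicator {0..R} r * w0 r"
    let ?F = "\<lambda>r. LINT x:{-r..r}|lborel. f x"
    have L: "integrable lborel (\<lambda>r. ?w r * ?F r)"
      "(LINT x|lborel. f x * bump R 0 x ^ m) = (LINT r|lborel. ?w r * ?F r)"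
      using integral_mult_bump_power[OF f int[OF R] R m] unfolding w0_def .
    have w0_nonneg: "w0 r \<ge> 0" if "0 \<le> r" "r \<le> R" for r
      using that R unfolding w0_def by (auto simp: divide_simps power_mono intro!: mult_nonneg_nonneg)
    have wi: "integrable lborel (\<lambda>s. indicator {r..R} s * w0 s)" for r
    proof -
      have "set_integrable lborel {r..R} w0" unfolding w0_def
        using R by (intro borel_integrable_atLeastAtMost') (auto intro!: continuous_intros)
      then show ?thesis by (simp add: set_integrable_def)
    qed
    have I: "(LINT s|lborel. indicator {r..R} s * w0 s) = (1 - r\<^sup>2 / R\<^sup>2) ^ m" if "0 \<le> r" "r \<le> R" for r
      unfolding w0_def using integral_bump_weight[OF that R m] .
    \<comment> \<open>The integrand on the right equals \<open>c * w0 r\<close> on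
      \<open>{\<rho>..R}\<close> and \<open>- B * w0 r\<close> on \<open>{0..<\<rho>}\<close>, which
      is the pointwise lower bound for \<open>?w r * ?F r\<close>.\<close>
    have "c - (B + c) * (1 - (1 - \<rho>\<^sup>2 / R\<^sup>2) ^ m)
        = (LINT r|lborel. c * ?w r - (B + c) * (?w r - indicator {\<rho>..R} r * w0 r))"
      using I[of 0] I[of \<rho>] wi[of 0] wi[of \<rho>] R \<rho> elim by (simp add: wi)
    also have "\<dots> \<le> (LINT r|lborel. ?w r * ?F r)"
    proof (rule integral_mono)
      show "integrable lborel (\<lambda>r. c * ?w r - (B + c) * (?w r - indicator {\<rho>..R} r * w0 r))"
        by (intro Bochner_Integration.integrable_diff integrable_mult_right wi)
      show "integrable lborel (\<lambda>r. ?w r * ?F r)" by (rule L(1))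
      fix r
      consider "r \<notin> {0..R}" | "r \<in> {\<rho>..R}" | "r \<in> {0..<\<rho>}" by fastforce
      then show "c * ?w r - (B + c) * (?w r - indicator {\<rho>..R} r * w0 r) \<le> ?w r * ?F r"
      proof cases
        case 1
        then show ?thesis using \<rho> by (auto simp: indicator_def)
      next
        case 2
        then show ?thesis using \<rho> mult_left_mono[OF lower[of r] w0_nonneg[of r]]
          by (auto simp: mult.commute)
      next
        case 3
        then have "\<bar>?F r\<bar> \<le> B" by (intro Bl) auto
        then have "- B \<le> ?F r" by linarith
        then have "w0 r * (- B) \<le> w0 r * ?F r"
          using 3 elim by (intro mult_left_mono w0_nonneg) auto
        then show ?thesis using 3 elim by (auto simp: algebra_simps)
      qed
    qed
    also have "\<dots> = (LINT x|lborel. f x * bump R 0 x ^ m)" by (rule L(2)[symmetric])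
    finally show ?case using elim by linarith
  qed
qed

text \<open>With \<open>\<Lambda> = \<kappa> * \<Gamma> * q ^ m\<close>, split the product as
  \<open>X * w * \<Lambda> powr (1 / p)\<close> times
  \<open>A * q ^ (m - 2) * \<Lambda> powr (-1 / p)\<close> and use the exponents \<open>p\<close>
  and \<open>1 + s\<close>. The second factor leaves \<open>q powr (real m - 2 * (1 + s))\<close>,
  at most 1 by the choice of \<open>m\<close>.\<close>

lemma weighted_Youngs_inequality:
  fixes X :: real and m :: nat
  assumes p: "p > 1" and "\<kappa> > 0" "X \<ge> 0" "\<Gamma> > 0" "A \<ge> 0" "w \<ge> 0" "0 \<le> q" "q \<le> 1"
    and m: "real m \<ge> 2 * p / (p - 1)"
  shows "X * (A * w * q ^ (m - 2)) \<le> \<kappa> * (X powr p * (\<Gamma> * q ^ m) * w powr p)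
    + \<kappa> powr (-1 / (p - 1)) * A powr (p / (p - 1)) * \<Gamma> powr (-1 / (p - 1))"
proof -
  define s where "s = 1 / (p - 1)"
  have s: "s > 0" "p / (p - 1) = 1 + s" "-1 / (p - 1) = - s" "(1 + s) / p = s" "1 / p + 1 / (1 + s) = 1"
    using p by (auto simp: s_def divide_simps algebra_simps)
  have m2: "real m \<ge> 2 * (1 + s)" using m s(2) by (metis times_divide_eq_right)
  moreover have "2 < 2 * (1 + s)" using s(1) by simp
  ultimately have "real m > 2" by (rule less_le_trans[rotated])
  then have m3: "m \<ge> 3" by linarith
  show ?thesis
  proof (cases "q = 0")
    \<comment> \<open>Here \<open>\<Lambda>\<close> would vanish and the splitting break down, but
      \<open>m > 2\<close> makes the left-hand side 0.\<close>
    case True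
    then have "q ^ (m - 2) = 0" using m3 by (simp add: power_0_left)
    then have "X * (A * w * q ^ (m - 2)) = 0" by simp
    also have "0 \<le> \<kappa> * (X powr p * (\<Gamma> * q ^ m) * w powr p)
        + \<kappa> powr (-1 / (p - 1)) * A powr (p / (p - 1)) * \<Gamma> powr (-1 / (p - 1))"
      using assms by (intro add_nonneg_nonneg mult_nonneg_nonneg) auto
    finally show ?thesis .
  next
    case False
    define \<Lambda> where "\<Lambda> = \<kappa> * \<Gamma> * q ^ m"
    have q: "q > 0" and L: "\<Lambda> > 0" using False assms by (auto simp: \<Lambda>_def)
    have "X * (A * w * q ^ (m - 2)) = (X * w * \<Lambda> powr (1 / p)) * (A * q ^ (m - 2) * \<Lambda> powr (-1 / p))"
      using L by (simp add: powr_minus)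
    also have "\<dots> \<le> (X * w * \<Lambda> powr (1 / p)) powr p / p
        + (A * q ^ (m - 2) * \<Lambda> powr (-1 / p)) powr (1 + s) / (1 + s)"
      using p s assms by (intro Youngs_inequality) auto
    also have "\<dots> \<le> (X * w * \<Lambda> powr (1 / p)) powr p + (A * q ^ (m - 2) * \<Lambda> powr (-1 / p)) powr (1 + s)"
    proof -
      have "y / r \<le> y" if "y \<ge> 0" "r \<ge> 1" for y r :: real
        using divide_left_mono[of 1 r y] that by simp
      then show ?thesis using p s(1) by (intro add_mono) auto
    qed
    also have "(X * w * \<Lambda> powr (1 / p)) powr p = \<kappa> * (X powr p * (\<Gamma> * q ^ m) * w powr p)"
      using assms L p by (simp add: powr_mult powr_powr) (simp add: \<Lambda>_def mult_ac)
    also have "(A * q ^ (m - 2) * \<Lambda> powr (-1 / p)) powr (1 + s)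
        = A powr (1 + s) * (q ^ (m - 2)) powr (1 + s) * \<Lambda> powr (- s)"
      using assms L s by (simp add: powr_mult powr_powr)
    also have "\<Lambda> powr (- s) = \<kappa> powr (- s) * \<Gamma> powr (- s) * (q ^ m) powr (- s)"
      using assms q by (simp add: \<Lambda>_def powr_mult)
    also have "A powr (1 + s) * (q ^ (m - 2)) powr (1 + s) * (\<kappa> powr (- s) * \<Gamma> powr (- s) * (q ^ m) powr (- s))
        = \<kappa> powr (- s) * A powr (1 + s) * \<Gamma> powr (- s) * q powr (real m - 2 * (1 + s))"
    proof -
      have "real (m - 2) * (1 + s) + real m * (- s) = real m - 2 * (1 + s)"
        using m3 by (simp add: algebra_simps)
      then have "(q ^ (m - 2)) powr (1 + s) * (q ^ m) powr (- s) = q powr (real m - 2 * (1 + s))"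
        using q by (simp add: powr_powr flip: powr_realpow powr_add)
      then show ?thesis by (simp add: mult_ac)
    qed
    also have "\<dots> \<le> \<kappa> powr (- s) * A powr (1 + s) * \<Gamma> powr (- s) * 1"
      using m2 q assms by (intro mult_left_mono powr_le1) auto
    finally show ?thesis unfolding s by simp
  qed
qed

text \<open>The weight majorizes \<open>(1 + t) powr (-1 / (p - 1))\<close> when
  \<open>p \<le> 3\<close>. Its integral grows like \<open>R powr (3/2)\<close>, the rate that the
  remainder in Young's inequality has to compensate.\<close>

lemma
  assumes "R \<ge> 0"
  defines "D \<equiv> \<lambda>z. indicator ({0..R} \<times> {-R..R}) z * (1 + fst z) powr (-1/2)"
  shows integrable_weight_rectangle: "integrable lborel D"
    and integral_weight_rectangle: "(LINT z|lborel. D z) \<le> 4 * R * sqrt (1 + R)"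
proof -
  define d where "d = (\<lambda>t. indicator {0..R} t * (1 + t) powr (-1/2))"
  have d_int: "integrable lborel d"
  proof -
    have "set_integrable lborel {0..R} (\<lambda>t. (1 + t) powr (-1/2))"
      by (intro borel_integrable_atLeastAtMost') (auto intro!: continuous_intros)
    then show ?thesis by (simp add: d_def set_integrable_def)
  qed
  have d_nonneg: "d t \<ge> 0" for t by (auto simp: d_def)
  have d_LINT: "(LINT t|lborel. d t) = 2 * sqrt (1 + R) - 2"
  proof -
    have "(LINT t|lborel. indicator {0..R} t *\<^sub>R (1 + t) powr (-1/2)) = 2 * (1 + R) powr (1/2) - 2 * (1 + 0) powr (1/2)"
      using assms
      by (intro integral_FTC_atLeastAtMost)
         (auto intro!: derivative_eq_intros continuous_intros simp flip: has_real_derivative_iff_has_vector_derivative)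
    then show ?thesis using assms by (simp add: d_def powr_half_sqrt)
  qed
  have D: "D (t, x) = d t * indicator {-R..R} x" for t x
    by (auto simp: D_def d_def indicator_def)
  have Dx: "(LINT x|lborel. D (t, x)) = 2 * R * d t" "integrable lborel (\<lambda>x. D (t, x))" for t
    using assms unfolding D by (auto simp: mult_ac intro!: integrable_mult_right)
  have Dm: "D \<in> borel_measurable (lborel \<Otimes>\<^sub>M lborel)"
    unfolding D_def by measurable
  have "integrable (lborel \<Otimes>\<^sub>M lborel) D"
  proof (rule lborel_pair.Fubini_integrable[OF Dm])
    have "norm (D (t, x)) = D (t, x)" for t x using d_nonneg by (simp add: D)
    then show "integrable lborel (\<lambda>t. LINT x|lborel. norm (D (t, x)))"
      using d_int by (simp add: Dx)
    show "AE t in lborel. integrable lborel (\<lambda>x. D (t, x))" using Dx by simp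
  qed
  note I = this lborel_pair.integral_fst'[OF this]
  show "integrable lborel D" using I(1) by (simp add: lborel_prod)
  have "(LINT z|lborel. D z) = 2 * R * (2 * sqrt (1 + R) - 2)"
    using I(2) unfolding Dx lborel_prod by (simp add: d_LINT)
  also have "\<dots> \<le> 2 * R * (2 * sqrt (1 + R))" using assms by (intro mult_left_mono) auto
  finally show "(LINT z|lborel. D z) \<le> 4 * R * sqrt (1 + R)" by simp
qed

text \<open>Because \<open>\<omega> \<le> 1\<close>, the choice \<open>\<kappa> = 1/2\<close>
  absorbs the weighted integral and bounds the integrals of \<open>V * \<phi> n\<close> uniformly.
  Monotone convergence then makes \<open>V\<close> integrable, so the weighted integrals tend to 0
  by dominated convergence.\<close>

lemma rescaled_test_functions_contradiction:
  fixes V :: "'a \<Rightarrow> real" and \<phi> \<omega> :: "nat \<Rightarrow> 'a \<Rightarrow> real"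
  assumes V: "\<And>z. V z \<ge> 0" and int: "\<And>n. integrable M (\<lambda>z. V z * \<phi> n z)"
    and \<phi>: "\<And>n z. 0 \<le> \<phi> n z" "\<And>n z. \<phi> n z \<le> 1" "\<And>z. incseq (\<lambda>n. \<phi> n z)" "\<And>z. (\<lambda>n. \<phi> n z) \<longlonglongrightarrow> 1"
    and \<omega>: "\<And>n z. 0 \<le> \<omega> n z" "\<And>n z. \<omega> n z \<le> 1" "\<And>n. \<omega> n \<in> borel_measurable M"
      "\<And>z. (\<lambda>n. \<omega> n z) \<longlonglongrightarrow> 0"
    and s: "s > 0" and c: "c > 0" and J: "\<forall>\<^sub>F n in sequentially. J n \<ge> c"
    and ineq: "\<And>n \<kappa>. \<kappa> > 0 \<Longrightarrow>
      J n + (LINT z|M. V z * \<phi> n z) \<le> \<kappa> * (LINT z|M. V z * \<phi> n z * \<omega> n z) + K * \<kappa> powr (- s)"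
  shows False
proof -
  let ?N = "\<lambda>n. LINT z|M. V z * \<phi> n z"
  have mV: "incseq (\<lambda>n. V z * \<phi> n z)" for z
    using \<phi>(3)[of z] V[of z] by (auto simp: incseq_def intro!: mult_left_mono)
  have le: "V z * \<phi> n z * \<omega> n z \<le> V z * \<phi> n z" for n z
    using V \<phi>(1) \<omega>(2) by (simp add: mult_left_le)
  have "\<forall>\<^sub>F n in sequentially. ?N n \<le> 2 * K * (1/2) powr (- s)"
    using J
  proof eventually_elim
    case (elim n)
    have "(LINT z|M. V z * \<phi> n z * \<omega> n z) \<le> ?N n"
      by (rule integral_mono'[OF int le]) (simp add: V \<phi>)
    then show ?case using ineq[of "1/2" n] elim c by simp
  qed
  then obtain n0 where n0: "\<And>n. n \<ge> n0 \<Longrightarrow> ?N n \<le> 2 * K * (1/2) powr (- s)"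
    by (auto simp: eventually_sequentially)
  have inc: "incseq ?N"
    using mV by (auto simp: incseq_def intro!: integral_mono int)
  have "?N n \<le> 2 * K * (1/2) powr (- s)" for n
    using incseqD[OF inc, of n "max n n0"] n0[of "max n n0"] by simp
  with inc obtain L where L: "?N \<longlonglongrightarrow> L"
    using incseq_convergent by blast
  have limV: "(\<lambda>n. V z * \<phi> n z) \<longlonglongrightarrow> V z" for z
    using tendsto_mult[OF tendsto_const \<phi>(4)] by simp
  \<comment> \<open>Measurability of \<open>V\<close> is inherited from the integrable functions
    \<open>V * \<phi> n\<close>, which converge to it pointwise.\<close>
  have "V \<in> borel_measurable M"
    by (rule borel_measurable_LIMSEQ_real[OF limV]) (use int in auto)
  then have intV: "integrable M V"
    by (intro integrable_monotone_convergence[where f = "\<lambda>n z. V z * \<phi> n z", OF int _ _ L])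
       (use mV limV in \<open>auto simp: incseq_def mono_def\<close>)
  have "(\<lambda>n. LINT z|M. V z * \<phi> n z * \<omega> n z) \<longlonglongrightarrow> (LINT z|M. 0)"
  proof (rule integral_dominated_convergence[OF _ _ intV])
    show "AE z in M. (\<lambda>n. V z * \<phi> n z * \<omega> n z) \<longlonglongrightarrow> 0"
      using tendsto_mult[OF limV \<omega>(4)] by simp
    have "V z * \<phi> n z \<le> V z" for n z using V \<phi> by (simp add: mult_left_le)
    then show "AE z in M. norm (V z * \<phi> n z * \<omega> n z) \<le> V z" for n
      using V \<phi> \<omega> by (auto intro!: order_trans[OF le])
    show "(\<lambda>z. V z * \<phi> n z * \<omega> n z) \<in> borel_measurable M" for n
      by (rule borel_measurable_times[OF borel_measurable_integrable[OF int] \<omega>(3)])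
  qed auto
  then have lim0: "(\<lambda>n. LINT z|M. V z * \<phi> n z * \<omega> n z) \<longlonglongrightarrow> 0" by simp
  \<comment> \<open>The order of limits matters: \<open>\<kappa>\<close> multiplies the weighted
    integral, so \<open>n\<close> goes to infinity for fixed \<open>\<kappa>\<close>, and only
    afterwards does \<open>\<kappa>\<close> grow.\<close>
  have bound: "c \<le> K * \<kappa> powr (- s)" if "\<kappa> > 0" for \<kappa>
  proof (rule tendsto_lowerbound)
    show "(\<lambda>n. \<kappa> * (LINT z|M. V z * \<phi> n z * \<omega> n z) + K * \<kappa> powr (- s)) \<longlonglongrightarrow> K * \<kappa> powr (- s)"
      using tendsto_add[OF tendsto_mult[OF tendsto_const lim0] tendsto_const] by simp
    show "\<forall>\<^sub>F n in sequentially. c \<le> \<kappa> * (LINT z|M. V z * \<phi> n z * \<omega> n z) + K * \<kappa> powr (- s)"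
      using J
    proof eventually_elim
      case (elim n)
      have "0 \<le> ?N n" by (intro Bochner_Integration.integral_nonneg) (simp add: V \<phi>)
      then show ?case using elim ineq[OF that, of n] by linarith
    qed
  qed auto
  have "((\<lambda>\<kappa>. K * \<kappa> powr (- s)) \<longlongrightarrow> K * 0) at_top"
    using s by (intro tendsto_intros tendsto_neg_powr filterlim_ident) auto
  then have "c \<le> K * 0"
    by (rule tendsto_lowerbound[OF _ eventually_mono[OF eventually_gt_at_top[of 0] bound]]) auto
  then show False using c by simp
qed

subsection \<open>The blow-up alternative\<close>

lemma L2_norm_cong_AE:
  assumes "f \<in> borel_measurable lborel" "f' \<in> borel_measurable lborel" "AE x in lborel. f x = f' x"
  shows "L2_norm f = L2_norm f'"
proof -
  have "(LINT x|lborel. (f x)\<^sup>2) = (LINT x|lborel. (f' x)\<^sup>2)"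
    using assms(3) by (intro integral_cong_AE borel_measurable_power assms(1,2)) auto
  then show ?thesis by (simp add: L2_norm_def)
qed

lemma L2_measurable: "L2 f \<Longrightarrow> f \<in> borel_measurable lborel"
  by (simp add: L2_def)

lemma is_weak_deriv_cong_AE:
  assumes "f \<in> borel_measurable lborel" "f' \<in> borel_measurable lborel" "AE x in lborel. f x = f' x"
  shows "is_weak_deriv f v \<longleftrightarrow> is_weak_deriv f' v"
proof -
  have "(LINT x|lborel. f x * deriv \<phi> x) = (LINT x|lborel. f' x * deriv \<phi> x)"
    if "smooth_compact_support \<phi>" for \<phi>
  proof -
    have "deriv \<phi> field_differentiable (at x)" for x
      using that unfolding smooth_compact_support_def by (metis funpow_0 funpow.simps(2) o_apply)
    \<comment> \<open>Congruence of integrals almost everywhere needs measurable integrands; for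
      \<open>deriv \<phi>\<close> this comes from its continuity.\<close>
    then have "continuous_on UNIV (deriv \<phi>)"
      by (auto intro!: continuous_at_imp_continuous_on field_differentiable_imp_continuous_at)
    then have "deriv \<phi> \<in> borel_measurable lborel"
      by (simp add: borel_measurable_continuous_onI)
    then show ?thesis
      using assms(3) by (intro integral_cong_AE borel_measurable_times assms(1,2)) auto
  qed
  then show ?thesis by (simp add: is_weak_deriv_def)
qed

lemma H1_norm_cong_AE:
  assumes "H1 f" "H1 f'" "AE x in lborel. f x = f' x"
  shows "H1_norm f = H1_norm f'"
proof -
  have m: "f \<in> borel_measurable lborel" "f' \<in> borel_measurable lborel"
    using assms by (auto simp: H1_def L2_def)
  \<comment> \<open>Both functions have the same set of weak derivatives, so \<open>SOME\<close>
    selects literally the same one.\<close>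
  have "weak_deriv f = weak_deriv f'"
    unfolding weak_deriv_def is_weak_deriv_cong_AE[OF m assms(3)] ..
  then show ?thesis by (simp add: H1_norm_def L2_norm_cong_AE[OF m assms(3)])
qed

text \<open>\<open>time_set T\<close> is relatively open in \<open>{0..}\<close>, so limits within
  \<open>{0..}\<close> at its points see only times before \<open>T\<close>, where two solutions can
  be compared.\<close>

lemma eventually_time_set:
  assumes "t \<in> time_set T"
  shows "\<forall>\<^sub>F s in at t within {0..}. s \<in> time_set T"
proof -
  have "ereal t < T" using assms by (simp add: time_set_def)
  then obtain r where r: "t < r" "ereal r < T"
    using ereal_dense2 by (metis ereal_less_eq(3) less_ereal.simps(1))
  have "\<forall>\<^sub>F s in at t within {0..}. s < r"
    using r(1) order_tendstoD(2)[OF tendsto_ident_at] by blast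
  moreover have "\<forall>\<^sub>F s in at t within {0..}. 0 \<le> s"
    by (auto simp: eventually_at_filter)
  ultimately show ?thesis
  proof eventually_elim
    case (elim s)
    then have "ereal s < ereal r" by simp
    then show ?case using elim less_trans[OF _ r(2)] by (auto simp: time_set_def)
  qed
qed

lemma has_L2_time_deriv_cong_AE:
  assumes meas: "\<And>s. s \<in> time_set T \<Longrightarrow> u s \<in> borel_measurable lborel"
    "\<And>s. s \<in> time_set T \<Longrightarrow> v s \<in> borel_measurable lborel"
    and eq: "\<And>s. s \<in> time_set T \<Longrightarrow> AE x in lborel. u s x = v s x"
    and t: "t \<in> time_set T"
  shows "has_L2_time_deriv u t w \<longleftrightarrow> has_L2_time_deriv v t w"
proof (cases "L2 w")
  \<comment> \<open>If \<open>L2 w\<close> fails, both sides are false by definition. Here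
    \<open>w\<close> is measurable, as the congruence of the \<open>L2_norm\<close> of the
    difference quotients requires.\<close>
  case True
  have "\<forall>\<^sub>F s in at t within {0..}. L2_norm (\<lambda>x. (u s x - u t x) / (s - t) - w x)
      = L2_norm (\<lambda>x. (v s x - v t x) / (s - t) - w x)"
    using eventually_time_set[OF t]
  proof eventually_elim
    case (elim s)
    show ?case
    proof (rule L2_norm_cong_AE)
      show "AE x in lborel. (u s x - u t x) / (s - t) - w x = (v s x - v t x) / (s - t) - w x"
        using eq[OF elim] eq[OF t] by eventually_elim simp
    qed (intro borel_measurable_diff borel_measurable_divide borel_measurable_const
        meas[OF elim] meas[OF t] L2_measurable[OF True])+
  qed
  then show ?thesis unfolding has_L2_time_deriv_def by (simp add: tendsto_cong)
qed (simp add: has_L2_time_deriv_def)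

lemma state_norm_cong_AE:
  assumes u: "X_space T u" and v: "X_space T v"
    and eq: "\<And>s. s \<in> time_set T \<Longrightarrow> AE x in lborel. u s x = v s x"
    and t: "t \<in> time_set T"
  shows "state_norm u t = state_norm v t"
proof -
  have H: "H1 (u s)" "H1 (v s)" if "s \<in> time_set T" for s
    using u v that by (auto simp: X_space_def)
  then have m: "u s \<in> borel_measurable lborel" "v s \<in> borel_measurable lborel" if "s \<in> time_set T" for s
    using that by (auto simp: H1_def L2_def)
  \<comment> \<open>Equality of the predicates, and not just equivalence of their solvability, makes
    the choice in \<open>L2_time_deriv\<close> agree for \<open>u\<close> and
    \<open>v\<close>.\<close>
  have "has_L2_time_deriv u t = has_L2_time_deriv v t"
    by (intro ext has_L2_time_deriv_cong_AE[OF m(1) m(2) eq t])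
  then have "L2_time_deriv u t = L2_time_deriv v t"
    by (simp add: L2_time_deriv_def)
  then show ?thesis
    by (simp add: state_norm_def H1_norm_cong_AE[OF H[OF t] eq[OF t]])
qed

text \<open>The existence theorem yields blow-up for some maximal solution \<open>v\<close>.
  Maximality of both lifespans gives \<open>T' = T\<close>, uniqueness identifies \<open>u\<close>
  and \<open>v\<close> almost everywhere at each time, and so their state norms coincide up to
  \<open>T\<close>.\<close>

lemma local_solution_blows_up:
  assumes ex: "local_existence a p" and "H1 u0" "L2 u1"
    and loc: "local_solution a p u0 u1 T u" and T: "T < \<infinity>"
  shows "norm_blows_up T u"
proof -
  from ex \<open>H1 u0\<close> \<open>L2 u1\<close> obtain T' v where v: "local_solution a p u0 u1 T' v"
    and uniq: "\<And>w t. weak_solution a p u0 u1 T' w \<Longrightarrow> t \<in> time_set T' \<Longrightarrow> AE x in lborel. w t x = v t x"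
    and blow: "T' < \<infinity> \<Longrightarrow> norm_blows_up T' v"
    unfolding local_existence_def by blast
  have TT: "T' = T"
    using v loc unfolding local_solution_def by (meson antisym)
  have u: "weak_solution a p u0 u1 T u" and v': "weak_solution a p u0 u1 T v"
    using loc v TT by (auto simp: local_solution_def)
  then have X: "X_space T u" "X_space T v" and T0: "0 < T"
    by (auto simp: weak_solution_def)
  define \<tau> where "\<tau> = real_of_ereal T"
  have \<tau>: "T = ereal \<tau>" "0 < \<tau>"
    using T T0 by (cases T; auto simp: \<tau>_def)+
  have "\<forall>\<^sub>F t in at_left \<tau>. 0 < t \<and> t < \<tau>"
    using eventually_at_left_real[OF \<tau>(2)] by simp
  then have "\<forall>\<^sub>F t in at_left \<tau>. state_norm v t = state_norm u t"
  proof eventually_elim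
    case (elim t)
    then have "t \<in> time_set T" by (simp add: time_set_def \<tau>)
    then show ?case
      using state_norm_cong_AE[OF X uniq[OF u[folded TT], unfolded TT]] by simp
  qed
  then show ?thesis
    using blow T unfolding TT norm_blows_up_def \<tau>_def[symmetric]
    by (simp add: filterlim_cong[OF refl refl])
qed

subsection \<open>Nonexistence of global solutions\<close>

lemma C1_strip_scattering_damping:
  assumes "C2_strip \<infinity> b"
  shows "C1_strip \<infinity> (\<lambda>t x. 2 / (1 + t) + b t x)"
proof (rule C1_strip_add)
  show "C1_strip \<infinity> (\<lambda>t x. 2 / (1 + t))"
    by (rule C1_strip_time_fun[where q' = "\<lambda>t. - 2 / (1 + t)\<^sup>2"])
       (auto intro!: derivative_eq_intros continuous_intros simp: power2_eq_square)
qed (use assms in \<open>simp add: C2_strip_def\<close>)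

lemma corrector_derivatives:
  assumes h: "C2_strip \<infinity> h" and t: "t \<ge> 0"
  defines "g \<equiv> \<lambda>t x. (1 + t) * (1 + h t x)"
  shows "C2_strip \<infinity> g"
    and "Dt g t x = 1 + h t x + (1 + t) * Dt h t x"
    and "Dx g t x = (1 + t) * Dx h t x"
    and "Dt (Dt g) t x = 2 * Dt h t x + (1 + t) * Dt (Dt h) t x"
    and "Dx (Dx g) t x = (1 + t) * Dx (Dx h) t x"
proof -
  note D = C2_stripD[OF h]
  show "C2_strip \<infinity> g"
    unfolding g_def
    using C2_strip_mult[OF C2_strip_affine_time[of 1 1] C2_strip_add[OF C2_strip_affine_time[of 1 0] h]]
    by simp
  have gt: "Dt g t x = 1 + h t x + (1 + t) * Dt h t x" if "t \<ge> 0" for t x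
    unfolding g_def by (rule Dt_eq[OF that])
      (auto intro!: derivative_eq_intros C1_strip_Dt[OF D(1) that])
  have gx: "Dx g t x = (1 + t) * Dx h t x" if "t \<ge> 0" for t x
    unfolding g_def by (rule Dx_eq) (auto intro!: derivative_eq_intros C1_strip_Dx[OF D(1) that])
  show "Dt g t x = 1 + h t x + (1 + t) * Dt h t x" "Dx g t x = (1 + t) * Dx h t x"
    by (simp_all add: gt gx t)
  have "Dt (Dt g) t x = Dt (\<lambda>t x. 1 + h t x + (1 + t) * Dt h t x) t x"
    by (intro Dt_cong gt t)
  also have "\<dots> = 2 * Dt h t x + (1 + t) * Dt (Dt h) t x"
    by (rule Dt_eq[OF t])
       (auto intro!: derivative_eq_intros C1_strip_Dt[OF D(1) t] C1_strip_Dt[OF D(2) t])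
  finally show "Dt (Dt g) t x = \<dots>" .
  have "Dx (Dx g) t x = Dx (\<lambda>t x. (1 + t) * Dx h t x) t x"
    by (intro Dx_cong gx t)
  also have "\<dots> = (1 + t) * Dx (Dx h) t x"
    by (rule Dx_eq) (auto intro!: derivative_eq_intros C1_strip_Dx[OF D(3) t])
  finally show "Dx (Dx g) t x = \<dots>" .
qed

text \<open>The factor \<open>1 + t\<close> cancels the singular part of \<open>a\<close>, leaving
  \<open>a g = 2 (1 + h) + b g\<close>. The terms \<open>2 * Dt h\<close> in
  \<open>Dt (Dt g)\<close> and \<open>Dt (a g)\<close> then cancel, and what remains is
  \<open>1 + t\<close> times the expression in \<open>eqH\<close>.\<close>

lemma corrector_adjoint_equation:
  assumes b: "C2_strip \<infinity> b" and h: "C2_strip \<infinity> h" and eq: "eqH b h" and t: "t \<ge> 0"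
  defines "g \<equiv> \<lambda>t x. (1 + t) * (1 + h t x)" and "a \<equiv> \<lambda>t x. 2 / (1 + t) + b t x"
  shows "Dt (Dt g) t x - Dx (Dx g) t x - Dt (\<lambda>s y. a s y * g s y) t x = 0"
proof -
  note D = C2_stripD[OF h] and Db = C2_stripD[OF b]
  have "Dt (\<lambda>s y. a s y * g s y) t x = Dt (\<lambda>s y. 2 * (1 + h s y) + b s y * ((1 + s) * (1 + h s y))) t x"
    by (rule Dt_cong) (auto simp: a_def g_def t field_simps)
  also have "\<dots> = 2 * Dt h t x + (Dt b t x * ((1 + t) * (1 + h t x))
      + b t x * ((1 + h t x) + (1 + t) * Dt h t x))"
    by (rule Dt_eq[OF t])
       (auto intro!: derivative_eq_intros C1_strip_Dt[OF D(1) t] C1_strip_Dt[OF Db(1) t])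
  finally have ag: "Dt (\<lambda>s y. a s y * g s y) t x = \<dots>" .
  have e: "Dt (Dt h) t x - Dx (Dx h) t x - b t x * Dt h t x
        - (b t x / (1 + t) + Dt b t x) * (1 + h t x) = 0"
    using eq t by (simp add: eqH_def)
  have "Dt (Dt g) t x - Dx (Dx g) t x - Dt (\<lambda>s y. a s y * g s y) t x
      = (1 + t) * (Dt (Dt h) t x - Dx (Dx h) t x - b t x * Dt h t x
        - (b t x / (1 + t) + Dt b t x) * (1 + h t x))"
    unfolding ag corrector_derivatives(4,5)[OF h t, folded g_def]
    using t by (simp add: field_simps)
  then show ?thesis unfolding e by simp
qed

text \<open>Since \<open>k > 1\<close>, the functions \<open>b\<close>, \<open>Dt h\<close> and
  \<open>Dx h\<close> decay at least like \<open>1 / (1 + t)\<close> and stay bounded after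
  multiplication by \<open>1 + t\<close>; since \<open>\<theta> < 1\<close>, the factor
  \<open>1 + h\<close> stays between \<open>1 - \<theta>\<close> and 2.\<close>

lemma corrector_bounds:
  assumes b: "condA k \<delta> b" and h: "C2_strip \<infinity> h" "condB \<theta> k h"
    and par: "0 < \<theta>" "\<theta> < 1" "k > 1" "\<delta> > 0"
  defines "g \<equiv> \<lambda>t x. (1 + t) * (1 + h t x)" and "a \<equiv> \<lambda>t x. 2 / (1 + t) + b t x"
  obtains G where "G > 0" "\<And>t x. t \<ge> 0 \<Longrightarrow> \<bar>Dt g t x\<bar> \<le> G" "\<And>t x. t \<ge> 0 \<Longrightarrow> \<bar>Dx g t x\<bar> \<le> G"
    "\<And>t x. t \<ge> 0 \<Longrightarrow> \<bar>a t x * g t x\<bar> \<le> G" "\<And>t x. t \<ge> 0 \<Longrightarrow> \<bar>g t x\<bar> \<le> G * (1 + t)"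
    "\<And>t x. t \<ge> 0 \<Longrightarrow> g t x \<ge> (1 - \<theta>) * (1 + t)"
proof -
  obtain C where C: "C > 0"
    and hC: "\<And>t x. t \<ge> 0 \<Longrightarrow> \<bar>h t x\<bar> \<le> \<theta> / (1 + t) powr (k - 1) \<and>
        \<bar>Dt h t x\<bar> + \<bar>Dx h t x\<bar> \<le> C / (1 + t) powr k"
    using h(2) unfolding condB_def by blast
  have decay: "(1 + t) * y \<le> c" if "t \<ge> 0" "y \<le> c / (1 + t) powr k" "c > 0" for t y c
  proof -
    have "(1 + t) powr 1 \<le> (1 + t) powr k" using that par by (intro powr_mono) auto
    then have "(1 + t) * (c / (1 + t) powr k) \<le> c"
      using that by (simp add: divide_simps mult_ac mult_left_mono)
    then show ?thesis
      using mult_left_mono[OF that(2), of "1 + t"] that(1) by linarith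
  qed
  have h1: "\<bar>h t x\<bar> \<le> \<theta>" if "t \<ge> 0" for t x
  proof -
    have "1 \<le> (1 + t) powr (k - 1)" using that par by (simp add: ge_one_powr_ge_zero)
    then have "\<theta> / (1 + t) powr (k - 1) \<le> \<theta> / 1" using par by (intro divide_left_mono) auto
    then show ?thesis using hC[OF that, of x] by simp
  qed
  have ht: "(1 + t) * \<bar>Dt h t x\<bar> \<le> C" "(1 + t) * \<bar>Dx h t x\<bar> \<le> C" if "t \<ge> 0" for t x
    using hC[OF that, of x] C that by (auto intro!: decay)
  have b1: "(1 + t) * \<bar>b t x\<bar> \<le> \<delta>" if "t \<ge> 0" for t x
  proof -
    have "\<bar>(Dt ^^ 0) ((Dx ^^ 0) b) t x\<bar> \<le> \<delta> / (1 + t) powr (k + real 0)"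
      using b that unfolding condA_def by blast
    then show ?thesis using that par by (intro decay) auto
  qed
  show ?thesis
  \<comment> \<open>One constant for all four upper bounds: \<open>2 + C\<close> for
    \<open>Dt g\<close>, \<open>C\<close> for \<open>Dx g\<close>, \<open>2 * (2 + \<delta>)\<close>
    for \<open>a g\<close>, and 2 for \<open>g / (1 + t)\<close>.\<close>
  proof (rule that[of "4 + C + 2 * \<delta>"])
    show "4 + C + 2 * \<delta> > 0" using C par by simp
    fix t x :: real assume t: "t \<ge> 0"
    note H = h1[OF t, of x]
    have H1: "\<bar>1 + h t x\<bar> \<le> 2" "1 - \<theta> \<le> 1 + h t x" using H par by linarith+
    have "\<bar>(1 + t) * Dt h t x\<bar> \<le> C" "\<bar>(1 + t) * Dx h t x\<bar> \<le> C" "\<bar>(1 + t) * b t x\<bar> \<le> \<delta>"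
      using ht[OF t, of x] b1[OF t, of x] t by (simp_all add: abs_mult)
    note B = this
    show "\<bar>Dt g t x\<bar> \<le> 4 + C + 2 * \<delta>"
      unfolding g_def corrector_derivatives(2)[OF h(1) t] using H1 B par by linarith
    show "\<bar>Dx g t x\<bar> \<le> 4 + C + 2 * \<delta>"
      unfolding g_def corrector_derivatives(3)[OF h(1) t] using B par C by linarith
    have "a t x * g t x = (2 + (1 + t) * b t x) * (1 + h t x)"
      using t by (simp add: a_def g_def field_simps)
    also have "\<bar>\<dots>\<bar> \<le> (2 + \<delta>) * 2"
      unfolding abs_mult using B H1 par by (intro mult_mono) auto
    finally show "\<bar>a t x * g t x\<bar> \<le> 4 + C + 2 * \<delta>" using C by simp
    have "\<bar>g t x\<bar> = (1 + t) * \<bar>1 + h t x\<bar>" using t by (simp add: g_def abs_mult)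
    also have "\<dots> \<le> (1 + t) * (4 + C + 2 * \<delta>)" using H1 C par t by (intro mult_left_mono) auto
    finally show "\<bar>g t x\<bar> \<le> (4 + C + 2 * \<delta>) * (1 + t)" by (simp add: mult.commute)
    show "g t x \<ge> (1 - \<theta>) * (1 + t)"
      using mult_right_mono[OF H1(2), of "1 + t"] t by (simp add: g_def mult.commute)
  qed
qed

section \<open>Exhaustion of the half plane by cutoffs of growing radius\<close>

lemma incseq_bump: "incseq (\<lambda>n. bump (real (Suc n)) t x)"
proof (rule incseq_SucI)
  fix n
  have "(t\<^sup>2 + x\<^sup>2) / (real (Suc (Suc n)))\<^sup>2 \<le> (t\<^sup>2 + x\<^sup>2) / (real (Suc n))\<^sup>2"
    by (intro divide_left_mono power_mono) auto
  then show "bump (real (Suc n)) t x \<le> bump (real (Suc (Suc n))) t x"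
    unfolding bump_def by (intro max.mono) auto
qed

lemma filterlim_real_Suc: "filterlim (\<lambda>n. real (Suc n)) at_top sequentially"
  by (rule filterlim_compose[OF filterlim_real_sequentially filterlim_Suc])

lemma bump_tendsto_1: "(\<lambda>n. bump (real (Suc n)) t x) \<longlonglongrightarrow> 1"
proof -
  have "(\<lambda>n. (t\<^sup>2 + x\<^sup>2) / (real (Suc n))\<^sup>2) \<longlonglongrightarrow> 0"
    by (intro real_tendsto_divide_at_top tendsto_const filterlim_pow_at_top filterlim_real_Suc) auto
  then have "(\<lambda>n. max 0 (1 - (t\<^sup>2 + x\<^sup>2) / (real (Suc n))\<^sup>2)) \<longlonglongrightarrow> max 0 (1 - 0)"
    by (intro tendsto_intros)
  then show ?thesis by (simp add: bump_def)
qed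

text \<open>The condition \<open>p \<le> 3\<close> amounts to \<open>s \<ge> 1/2\<close> and acts
  twice: it gives \<open>(1 + t) powr (- s) \<le> (1 + t) powr (-1/2)\<close>, and it makes the
  factor \<open>R powr - (1 + s)\<close> of the remainder outweigh the growth
  \<open>R powr (3/2)\<close> of the integrated weight.\<close>

lemma no_global_solution:
  assumes p: "1 < p" "p \<le> 3"
    and g: "C2_strip \<infinity> g" and a: "C1_strip \<infinity> a"
    and adj: "\<And>t x. t \<ge> 0 \<Longrightarrow>
      Dt (Dt g) t x - Dx (Dx g) t x - Dt (\<lambda>s y. a s y * g s y) t x = 0"
    and G: "G > 0" "\<And>t x. t \<ge> 0 \<Longrightarrow> \<bar>Dt g t x\<bar> \<le> G" "\<And>t x. t \<ge> 0 \<Longrightarrow> \<bar>Dx g t x\<bar> \<le> G"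
      "\<And>t x. t \<ge> 0 \<Longrightarrow> \<bar>a t x * g t x\<bar> \<le> G" "\<And>t x. t \<ge> 0 \<Longrightarrow> \<bar>g t x\<bar> \<le> G * (1 + t)"
    and \<gamma>: "\<gamma> > 0" "\<And>t x. t \<ge> 0 \<Longrightarrow> g t x \<ge> \<gamma> * (1 + t)"
    and u0: "u0 \<in> borel_measurable lborel" and u1: "u1 \<in> borel_measurable lborel"
    and data: "Liminf at_top (\<lambda>R::real. ereal (LINT x:{-R..R}|lborel.
           (- Dt g 0 x + g 0 x * a 0 x) * u0 x + g 0 x * u1 x)) > 0"
    and sol: "weak_solution a p u0 u1 \<infinity> u"
  shows False
proof -
  define s where "s = 1 / (p - 1)"
  have s: "s \<ge> 1/2" "p / (p - 1) = 1 + s" "-1 / (p - 1) = - s"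
    using p by (auto simp: s_def divide_simps)
  \<comment> \<open>Twice the conjugate exponent \<open>1 + s\<close>, rounded up; as it exceeds 2,
    \<open>m \<ge> 3\<close> and the test functions are of class C^2.\<close>
  define m where "m = nat \<lceil>2 * p / (p - 1)\<rceil>"
  have m: "real m \<ge> 2 * p / (p - 1)" unfolding m_def by (rule real_nat_ceiling_ge)
  have "2 * p / (p - 1) = 2 * (1 + s)" using s(2) by simp
  moreover have "2 < 2 * (1 + s)" using s(1) by simp
  ultimately have "real m > 2" using m by linarith
  then have m3: "m \<ge> 3" by linarith
  define f where "f = (\<lambda>x. (- Dt g 0 x + g 0 x * a 0 x) * u0 x + g 0 x * u1 x)"
  define S where "S = {0::real..} \<times> (UNIV :: real set)"
  define \<psi> where "\<psi> = (\<lambda>R t x. g t x * bump R t x ^ m)"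
  define L where "L = (\<lambda>R t x. Dt (Dt (\<psi> R)) t x - Dx (Dx (\<psi> R)) t x - Dt (\<lambda>s y. a s y * \<psi> R s y) t x)"
  define V where "V = (\<lambda>z. indicator S z * (\<bar>u (fst z) (snd z)\<bar> powr p * g (fst z) (snd z)))"
  define \<phi> where "\<phi> = (\<lambda>n z. bump (real (Suc n)) (fst z) (snd z) ^ m)"
  \<comment> \<open>On the support of the cutoff \<open>1 + t + \<bar>x\<bar> \<le> 3 * R\<close>
    for \<open>R = real (Suc n)\<close>, so the minimum changes nothing there; elsewhere it enforces
    the bound 1 needed for domination.\<close>
  define w where "w = (\<lambda>n z. min 1 ((1 + \<bar>fst z\<bar> + \<bar>snd z\<bar>) / (3 * real (Suc n))))"
  define \<omega> where "\<omega> = (\<lambda>n z. w n z powr p)"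
  define J where "J = (\<lambda>n. LINT x|lborel. f x * bump (real (Suc n)) 0 x ^ m)"
  \<comment> \<open>54 is 3 times the 18 of \<open>adjoint_cutoff_bound\<close>; the 3 compensates
    the denominator \<open>3 * R\<close> of \<open>w\<close>.\<close>
  define A where "A = 54 * G * (real m)\<^sup>2"
  define K where "K = 8 * A powr (1 + s) * \<gamma> powr (- s)"

  \<comment> \<open>The time derivative of the cutoff carries a factor \<open>t\<close> and vanishes
    at \<open>t = 0\<close>, so the initial term is exactly the data integrand times the
    profile.\<close>
  have init: "(a 0 x * u0 x + u1 x) * \<psi> R 0 x - u0 x * Dt (\<psi> R) 0 x = f x * bump R 0 x ^ m" for R x
  proof -
    have "Dt (\<psi> R) 0 x = Dt g 0 x * bump R 0 x ^ m"
      unfolding \<psi>_def using m3 g C1_strip_bump_power[of m R]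
      by (subst Dt_mult) (auto simp: C2_strip_def Dt_bump_power)
    then show ?thesis by (simp add: \<psi>_def f_def algebra_simps)
  qed
  have weak: "integrable lborel (\<lambda>z. indicator S z * (u (fst z) (snd z) * L R (fst z) (snd z)))"
    "integrable lborel (\<lambda>x. f x * bump R 0 x ^ m)"
    "integrable lborel (\<lambda>z. V z * bump R (fst z) (snd z) ^ m)"
    "(LINT z|lborel. indicator S z * (u (fst z) (snd z) * L R (fst z) (snd z)))
      = (LINT x|lborel. f x * bump R 0 x ^ m) + (LINT z|lborel. V z * bump R (fst z) (snd z) ^ m)"
    if "R > 0" for R
  proof -
    have "C2_compact_support \<infinity> (\<psi> R)"
      unfolding \<psi>_def by (rule C2_compact_support_mult_bump_power[OF g m3 that])
    then have W: "set_integrable lborel S (\<lambda>(t, x). u t x * L R t x) \<and>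
      integrable lborel (\<lambda>x. (a 0 x * u0 x + u1 x) * \<psi> R 0 x - u0 x * Dt (\<psi> R) 0 x) \<and>
      set_integrable lborel S (\<lambda>(t, x). \<bar>u t x\<bar> powr p * \<psi> R t x) \<and>
      (LINT z:S|lborel. (\<lambda>(t, x). u t x * L R t x) z) =
        (LINT x|lborel. (a 0 x * u0 x + u1 x) * \<psi> R 0 x - u0 x * Dt (\<psi> R) 0 x)
        + (LINT z:S|lborel. (\<lambda>(t, x). \<bar>u t x\<bar> powr p * \<psi> R t x) z)"
      using sol unfolding weak_solution_def Let_def L_def S_def time_set_infinity by blast
    have "indicator S z * (\<bar>u (fst z) (snd z)\<bar> powr p * \<psi> R (fst z) (snd z))
        = V z * bump R (fst z) (snd z) ^ m" for z
      by (simp add: V_def \<psi>_def)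
    note W' = W[unfolded init set_integrable_def set_lebesgue_integral_def case_prod_unfold
        real_scaleR_def this]
    then show "integrable lborel (\<lambda>z. indicator S z * (u (fst z) (snd z) * L R (fst z) (snd z)))"
      "integrable lborel (\<lambda>x. f x * bump R 0 x ^ m)"
      "integrable lborel (\<lambda>z. V z * bump R (fst z) (snd z) ^ m)"
      "(LINT z|lborel. indicator S z * (u (fst z) (snd z) * L R (fst z) (snd z)))
        = (LINT x|lborel. f x * bump R 0 x ^ m) + (LINT z|lborel. V z * bump R (fst z) (snd z) ^ m)"
      by blast+
  qed

  have fm: "f \<in> borel_measurable lborel"
  proof -
    have "continuous_on UNIV (\<lambda>x. e 0 x)"
      if "continuous_on ({0..} \<times> UNIV) (\<lambda>(t, x). e t x)" for e :: "real \<Rightarrow> real \<Rightarrow> real"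
    proof -
      have "continuous_on UNIV (\<lambda>x::real. (0::real, x))" by (intro continuous_intros)
      from continuous_on_compose2[OF that this] show ?thesis by auto
    qed
    then have "continuous_on UNIV (\<lambda>x. g 0 x)" "continuous_on UNIV (\<lambda>x. Dt g 0 x)"
      "continuous_on UNIV (\<lambda>x. a 0 x)"
      using C1_strip_continuous[OF C2_stripD(1)[OF g]] C1_strip_continuous[OF a] by blast+
    then have "(\<lambda>x. g 0 x) \<in> borel_measurable lborel" "(\<lambda>x. Dt g 0 x) \<in> borel_measurable lborel"
      "(\<lambda>x. a 0 x) \<in> borel_measurable lborel"
      by (simp_all add: borel_measurable_continuous_onI)
    then show ?thesis unfolding f_def using u0 u1 by measurable
  qed
  obtain c where c: "c > 0" and J: "\<forall>\<^sub>F n in sequentially. J n \<ge> c"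
  proof -
    \<comment> \<open>The \<open>Liminf\<close> may be infinite, so a finite positive level strictly
      below it is fixed first.\<close>
    obtain c' where c': "0 < c'" "ereal c' < Liminf at_top (\<lambda>R::real. ereal (LINT x:{-R..R}|lborel. f x))"
      using ereal_dense2[OF data] by (auto simp: f_def)
    then have "\<forall>\<^sub>F R in at_top. c' < (LINT x:{-R..R}|lborel. f x)"
      using less_LiminfD by fastforce
    then obtain r where "\<And>R. R \<ge> r \<Longrightarrow> c' < (LINT x:{-R..R}|lborel. f x)"
      by (auto simp: eventually_at_top_linorder)
    then have "\<forall>\<^sub>F R in at_top. (LINT x|lborel. f x * bump R 0 x ^ m) \<ge> c' / 2"
      using weak(2) m3 c'(1)
      by (intro integral_mult_bump_power_lower_bound[OF fm, where \<rho> = "max r 1"]) (auto intro: less_imp_le)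
    then have "\<forall>\<^sub>F n in sequentially. J n \<ge> c' / 2"
      unfolding J_def by (rule eventually_compose_filterlim[OF _ filterlim_real_Suc])
    then show ?thesis using that c'(1) half_gt_zero by blast
  qed
  have \<omega>m: "\<omega> n \<in> borel_measurable lborel" for n
  proof -
    have "continuous_on UNIV (w n)" unfolding w_def by (intro continuous_intros) simp
    then have "w n \<in> borel_measurable lborel" by (simp add: borel_measurable_continuous_onI)
    then show ?thesis unfolding \<omega>_def by measurable
  qed
  have g_pos: "g t x > 0" if "t \<ge> 0" for t x
    using \<gamma>(2)[OF that, of x] \<gamma>(1) that by (smt (verit) mult_pos_pos)
  show False
  proof (rule rescaled_test_functions_contradiction[where M = lborel and V = V and \<phi> = \<phi> and \<omega> = \<omega>
        and s = s and c = c and J = J and K = K])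
    show "V z \<ge> 0" for z
      using g_pos by (auto simp: V_def S_def indicator_def less_imp_le)
    show "integrable lborel (\<lambda>z. V z * \<phi> n z)" for n
      unfolding \<phi>_def by (rule weak(3)) simp
    show "0 \<le> \<phi> n z" "\<phi> n z \<le> 1" for n z
      by (auto simp: \<phi>_def power_le_one)
    show "incseq (\<lambda>n. \<phi> n z)" for z
      using incseq_bump[of "fst z" "snd z"] by (auto simp: \<phi>_def incseq_def intro!: power_mono)
    show "(\<lambda>n. \<phi> n z) \<longlonglongrightarrow> 1" for z
      using tendsto_power[OF bump_tendsto_1, of "fst z" "snd z" m] by (simp add: \<phi>_def)
    show "0 \<le> \<omega> n z" for n z by (simp add: \<omega>_def)
    show "\<omega> n z \<le> 1" for n z
      unfolding \<omega>_def w_def using p by (intro powr_le1) auto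
    show "\<omega> n \<in> borel_measurable lborel" for n
      by (rule \<omega>m)
    show "(\<lambda>n. \<omega> n z) \<longlonglongrightarrow> 0" for z
    proof -
      have "filterlim (\<lambda>n. 3 * real (Suc n)) at_top sequentially"
        by (rule filterlim_tendsto_pos_mult_at_top[OF tendsto_const _ filterlim_real_Suc]) simp
      then have "(\<lambda>n. (1 + \<bar>fst z\<bar> + \<bar>snd z\<bar>) / (3 * real (Suc n))) \<longlonglongrightarrow> 0"
        by (rule real_tendsto_divide_at_top[OF tendsto_const])
      then have "(\<lambda>n. w n z) \<longlonglongrightarrow> min 1 0"
        unfolding w_def by (intro tendsto_min tendsto_const)
      then show ?thesis
        unfolding \<omega>_def using p
        by (intro tendsto_zero_powrI[where b = p]) (auto simp: w_def intro!: always_eventually)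
    qed
    show "s > 0" using s(1) by linarith
    show "c > 0" "\<forall>\<^sub>F n in sequentially. J n \<ge> c" by fact+
  next
    fix n :: nat and \<kappa> :: real assume \<kappa>: "\<kappa> > 0"
    define R where "R = real (Suc n)"
    \<comment> \<open>Radii start at 1, which is used for
      \<open>1 + t + \<bar>x\<bar> \<le> 3 * R\<close> and for
      \<open>1 + R \<le> 4 * R\<close>.\<close>
    have R: "R \<ge> 1" by (simp add: R_def)
    define D where "D = (\<lambda>z. indicator ({0..R} \<times> {-R..R}) z * (1 + fst z) powr (-1/2))"
    \<comment> \<open>The remainder in Young's inequality with
      \<open>\<Gamma> = g t x \<ge> \<gamma> * (1 + t)\<close>; its dependence on \<open>t\<close>
      is moved into \<open>D\<close>, whose rectangle contains the support of the cutoff in the half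
      plane.\<close>
    define E where "E = \<kappa> powr (- s) * (A / R) powr (1 + s) * \<gamma> powr (- s)"
    have E: "E \<ge> 0" by (simp add: E_def)
    have Vi: "integrable lborel (\<lambda>z. V z * \<phi> n z)" unfolding \<phi>_def by (rule weak(3)) simp
    have D: "integrable lborel D" "(LINT z|lborel. D z) \<le> 4 * R * sqrt (1 + R)"
      using integrable_weight_rectangle[of R] integral_weight_rectangle[of R] R by (auto simp: D_def)
    have VJ: "integrable lborel (\<lambda>z. V z * \<phi> n z * \<omega> n z)"
    proof (rule Bochner_Integration.integrable_bound[OF Vi])
      show "(\<lambda>z. V z * \<phi> n z * \<omega> n z) \<in> borel_measurable lborel"
        by (rule borel_measurable_times[OF borel_measurable_integrable[OF Vi] \<omega>m])
      have "\<omega> n z \<le> 1" "0 \<le> \<omega> n z" for z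
        unfolding \<omega>_def w_def using p by (auto intro!: powr_le1)
      then show "AE z in lborel. norm (V z * \<phi> n z * \<omega> n z) \<le> norm (V z * \<phi> n z)"
        by (auto simp: abs_mult intro!: mult_left_le)
    qed
    have pointwise: "indicator S z * (u (fst z) (snd z) * L R (fst z) (snd z))
        \<le> \<kappa> * (V z * \<phi> n z * \<omega> n z) + E * D z" for z
    proof (cases "z \<in> S")
      case False
      then show ?thesis using E by (simp add: V_def D_def S_def indicator_def split: prod.splits)
    next
      case True
      obtain t x where z: "z = (t, x)" by (cases z)
      have t: "t \<ge> 0" using True by (simp add: S_def z)
      define q where "q = bump R t x"
      have Lb: "\<bar>L R t x\<bar> \<le> 18 * G * (real m)\<^sup>2 * (1 + t + \<bar>x\<bar>) / R\<^sup>2 * q ^ (m - 2)"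
        unfolding L_def \<psi>_def q_def
        using R by (intro adjoint_cutoff_bound g a adj G t m3) auto
      show ?thesis
      proof (cases "q = 0")
        case True
        \<comment> \<open>Off the support \<open>q ^ (m - 2)\<close> is 0, so the bound
          \<open>Lb\<close> forces the operator term to vanish.\<close>
        then have "L R t x = 0" using Lb m3 by (simp add: power_0_left)
        moreover have "\<phi> n z = 0" using True m3 by (simp add: \<phi>_def q_def R_def z)
        ultimately show ?thesis using E by (simp add: z D_def)
      next
        case False
        have tx: "\<bar>t\<bar> \<le> R" "\<bar>x\<bar> \<le> R"
          using bump_pos_bounds[of R t x] False R by (auto simp: q_def)
        have wz: "w n z = (1 + t + \<bar>x\<bar>) / (3 * R)"
          using tx R t unfolding w_def z R_def[symmetric] by (simp add: min_def)
        have "u t x * L R t x \<le> \<bar>u t x\<bar> * \<bar>L R t x\<bar>" by (metis abs_ge_self abs_mult)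
        also have "\<dots> \<le> \<bar>u t x\<bar> * (18 * G * (real m)\<^sup>2 * (1 + t + \<bar>x\<bar>) / R\<^sup>2 * q ^ (m - 2))"
          using Lb by (intro mult_left_mono) auto
        also have "\<dots> = \<bar>u t x\<bar> * (A / R * w n z * q ^ (m - 2))"
          using R by (simp add: wz A_def power2_eq_square)
        also have "\<dots> \<le> \<kappa> * (\<bar>u t x\<bar> powr p * (g t x * q ^ m) * w n z powr p)
            + \<kappa> powr (-1 / (p - 1)) * (A / R) powr (p / (p - 1)) * g t x powr (-1 / (p - 1))"
          using \<kappa> p m R G(1) g_pos[OF t] t
          by (intro weighted_Youngs_inequality) (auto simp: q_def A_def wz)
        also have "\<kappa> * (\<bar>u t x\<bar> powr p * (g t x * q ^ m) * w n z powr p) = \<kappa> * (V z * \<phi> n z * \<omega> n z)"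
          using t by (simp add: V_def z S_def \<phi>_def q_def \<omega>_def R_def mult_ac)
        also have "\<kappa> powr (-1 / (p - 1)) * (A / R) powr (p / (p - 1)) * g t x powr (-1 / (p - 1)) \<le> E * D z"
        proof -
          have "g t x powr (- s) \<le> (\<gamma> * (1 + t)) powr (- s)"
            using \<gamma>(1) \<gamma>(2)[OF t, of x] s t by (intro powr_mono2') auto
          also have "\<dots> = \<gamma> powr (- s) * (1 + t) powr (- s)"
            using \<gamma>(1) t by (simp add: powr_mult)
          also have "\<dots> \<le> \<gamma> powr (- s) * (1 + t) powr (- 1/2)"
            using s t by (intro mult_left_mono powr_mono) auto
          finally have "\<kappa> powr (- s) * (A / R) powr (1 + s) * g t x powr (- s)
              \<le> \<kappa> powr (- s) * (A / R) powr (1 + s) * (\<gamma> powr (- s) * (1 + t) powr (- 1/2))"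
            by (intro mult_left_mono) auto
          then show ?thesis
            unfolding s using tx t by (simp add: E_def D_def z abs_le_iff mult_ac)
        qed
        finally show ?thesis using True by (simp add: z)
      qed
    qed
    have "J n + (LINT z|lborel. V z * \<phi> n z)
        = (LINT z|lborel. indicator S z * (u (fst z) (snd z) * L R (fst z) (snd z)))"
      using weak(4)[of R] R by (simp add: J_def \<phi>_def R_def)
    also have "\<dots> \<le> (LINT z|lborel. \<kappa> * (V z * \<phi> n z * \<omega> n z) + E * D z)"
      using R VJ D(1) by (intro integral_mono weak(1) pointwise) auto
    also have "\<dots> = \<kappa> * (LINT z|lborel. V z * \<phi> n z * \<omega> n z) + E * (LINT z|lborel. D z)"
      using VJ D(1) by simp
    also have "E * (LINT z|lborel. D z) \<le> E * (4 * R * sqrt (1 + R))"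
      using D(2) E by (rule mult_left_mono)
    \<comment> \<open>The powers of \<open>R\<close> cancel here: \<open>E\<close> contains
      \<open>(A / R) powr (1 + s)\<close>, while \<open>4 * R * sqrt (1 + R)\<close> is at most
      \<open>8 * R powr (1 + s)\<close>. This is the origin of the 8 in \<open>K\<close>.\<close>
    also have "\<dots> \<le> K * \<kappa> powr (- s)"
    proof -
      have "sqrt (1 + R) \<le> sqrt (4 * R)" using R by (intro real_sqrt_le_mono) auto
      also have "\<dots> = 2 * R powr (1/2)" using R by (simp add: real_sqrt_mult powr_half_sqrt)
      finally have "4 * R * sqrt (1 + R) \<le> 4 * R * (2 * R powr (1/2))"
        using R by (intro mult_left_mono) auto
      also have "\<dots> = 8 * R powr (1 + 1/2)"
        using R powr_add[of R 1 "1/2"] by simp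
      also have "\<dots> \<le> 8 * R powr (1 + s)"
        using R s by (intro mult_left_mono powr_mono) auto
      finally have "E * (4 * R * sqrt (1 + R)) \<le> E * (8 * R powr (1 + s))"
        using E by (intro mult_left_mono) auto
      also have "\<dots> = K * \<kappa> powr (- s)"
        using R G(1) by (simp add: E_def K_def A_def powr_divide)
      finally show ?thesis .
    qed
    finally show "J n + (LINT z|lborel. V z * \<phi> n z)
        \<le> \<kappa> * (LINT z|lborel. V z * \<phi> n z * \<omega> n z) + K * \<kappa> powr (- s)"
      by simp
  qed
qed


theorem theorem1p5:
  fixes p \<theta> k \<delta>\<^sub>0 \<delta> :: real
    and a b g h :: "real \<Rightarrow> real \<Rightarrow> real"
    and u0 u1 :: "real \<Rightarrow> real"
    and T :: ereal and u :: "real \<Rightarrow> real \<Rightarrow> real"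
  assumes "1 < p" and "p \<le> 3"
    and "0 < \<theta>" and "\<theta> < 1"
    and "k > 1"
    and "admissible_threshold \<theta> k \<delta>\<^sub>0"
    and "0 < \<delta>" and "\<delta> < \<delta>\<^sub>0"
    and "C2_strip \<infinity> b" and "condA k \<delta> b"
    and "a = (\<lambda>t x. 2 / (1 + t) + b t x)"
    and "C2_strip \<infinity> h" and "eqH b h" and "condB \<theta> k h"
    and "g = (\<lambda>t x. (1 + t) * (1 + h t x))"
    and "H1 u0" and "L2 u1"
    and "Liminf at_top (\<lambda>R::real. ereal (LINT x:{-R..R}|lborel.
           (- Dt g 0 x + g 0 x * a 0 x) * u0 x + g 0 x * u1 x)) > 0"
    and "local_existence a p"
    and "local_solution a p u0 u1 T u"
  shows "T < \<infinity> \<and> norm_blows_up T u"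
proof -
  note a = \<open>a = _\<close> and g = \<open>g = _\<close>
  obtain G where G: "G > 0" "\<And>t x. t \<ge> 0 \<Longrightarrow> \<bar>Dt g t x\<bar> \<le> G" "\<And>t x. t \<ge> 0 \<Longrightarrow> \<bar>Dx g t x\<bar> \<le> G"
    "\<And>t x. t \<ge> 0 \<Longrightarrow> \<bar>a t x * g t x\<bar> \<le> G" "\<And>t x. t \<ge> 0 \<Longrightarrow> \<bar>g t x\<bar> \<le> G * (1 + t)"
    "\<And>t x. t \<ge> 0 \<Longrightarrow> g t x \<ge> (1 - \<theta>) * (1 + t)"
    using corrector_bounds[OF \<open>condA k \<delta> b\<close> \<open>C2_strip \<infinity> h\<close> \<open>condB \<theta> k h\<close> \<open>0 < \<theta>\<close> \<open>\<theta> < 1\<close> \<open>k > 1\<close> \<open>0 < \<delta>\<close>]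
    unfolding a g by blast
  have gC2: "C2_strip \<infinity> g"
    unfolding g by (rule corrector_derivatives(1)[OF \<open>C2_strip \<infinity> h\<close> order_refl])
  have aC1: "C1_strip \<infinity> a"
    unfolding a by (rule C1_strip_scattering_damping[OF \<open>C2_strip \<infinity> b\<close>])
  have adj: "Dt (Dt g) t x - Dx (Dx g) t x - Dt (\<lambda>s y. a s y * g s y) t x = 0" if "t \<ge> 0" for t x
    unfolding a g
    by (rule corrector_adjoint_equation[OF \<open>C2_strip \<infinity> b\<close> \<open>C2_strip \<infinity> h\<close> \<open>eqH b h\<close> that])
  have "T \<noteq> \<infinity>"
  proof
    assume "T = \<infinity>"
    then have "weak_solution a p u0 u1 \<infinity> u"
      using \<open>local_solution a p u0 u1 T u\<close> by (simp add: local_solution_def)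
    moreover have "u0 \<in> borel_measurable lborel" "u1 \<in> borel_measurable lborel"
      using \<open>H1 u0\<close> \<open>L2 u1\<close> by (auto simp: H1_def L2_def)
    \<comment> \<open>The number \<open>1 - \<theta>\<close> serves as the constant
      \<open>\<gamma>\<close> in the lower bound for \<open>g\<close>.\<close>
    moreover have "1 - \<theta> > 0" using \<open>\<theta> < 1\<close> by simp
    ultimately show False
      using no_global_solution[OF \<open>1 < p\<close> \<open>p \<le> 3\<close> gC2 aC1 adj G(1-5) _ G(6)]
        \<open>Liminf at_top _ > 0\<close> by blast
  qed
  then have "T < \<infinity>" by (cases T) auto
  then show ?thesis
    using local_solution_blows_up \<open>local_existence a p\<close> \<open>H1 u0\<close> \<open>L2 u1\<close> \<open>local_solution a p u0 u1 T u\<close>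
    by blast
qed

end
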